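(* Let $e\ge1$ and let the dihedral group $G=C_e\rtimes S_2=\langle\rho,\sigma\rangle$ act on $B=\mathbb C[x_1,x_2]$ by $\rho(x_1)=\epsilon x_1$, $\rho(x_2)=\epsilon^{-1}x_2$, $\epsilon=\exp(2\pi i/e)$, and $\sigma$ interchanging $x_1$ and $x_2$. Put $\mathcal D_2=\mathcal D_B^G$ and $\nabla=x_1\partial_1+x_2\partial_2$. If $e$ is an odd integer, then the canonical composed homomorphism $$\Pi:\mathbb C[\nabla]\to\mathcal D_2^0\to\mathcal R_2=\frac{\mathcal D_2^0}{\mathcal D_2^0\cap(\mathcal D_2\cdot\mathcal D_2^-)}$$ is surjective. If $e=2e_1$ is an even integer, then $\mathcal R_2$ is generated as a module over $\mathcal E=\Pi(\mathbb C[\nabla])$ by (the classes of) the elements $1$ and $(x_1\partial_2)^{e_1}+(x_2\partial_1)^{e_1}\notin\mathcal E$. In either case $\mathcal R_2$ is commutative.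
   Context: $\mathcal D_B=\mathbb C\langle x_1,x_2,\partial_1,\partial_2\rangle$ is the Weyl algebra, graded by $\deg x_i=1$, $\deg\partial_i=-1$, with the induced action of $G$, $(g\cdot P)(b)=g(P(g^{-1}b))$. $\mathcal D_2^0$ is the degree $0$ part of $\mathcal D_2$ and $\mathcal D_2^-$ the sum of its parts of strictly negative degree; $\mathcal D_2\mathcal D_2^-$ is the left ideal generated by $\mathcal D_2^-$. *)

theory Defs
  imports
    Complex_Main
    "HOL-Computational_Algebra.Polynomial"
    "HOL-Algebra.Bij"
    "HOL-Algebra.Generated_Groups"
    "HOL-Algebra.Generated_Rings"
    "HOL-Algebra.Ideal_Product"
    "HOL-Algebra.QuotRing"
begin

text \<open>
  The polynomial ring \<open>B = \<complex>[x\<^sub>1,x\<^sub>2]\<close> is rendered as \<open>(\<complex>[x\<^sub>1])[x\<^sub>2]\<close>: the inner variable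
  is \<open>x\<^sub>1\<close>, the outer one \<open>x\<^sub>2\<close>.
\<close>

type_synonym B = "complex poly poly"

definition cst :: "complex \<Rightarrow> B" where "cst c = [:[:c:]:]"

definition X1 :: B where "X1 = [:[:0, 1:]:]"

definition X2 :: B where "X2 = [:0, 1:]"

text \<open>The \<open>\<complex>\<close>-algebra endomorphism of \<open>B\<close> with \<open>x\<^sub>1 \<mapsto> a\<close> and \<open>x\<^sub>2 \<mapsto> b\<close>.\<close>

definition subst :: "B \<Rightarrow> B \<Rightarrow> B \<Rightarrow> B" where
  "subst a b p = poly (map_poly (\<lambda>q. poly (map_poly cst q) a) p) b"


section \<open>The Weyl algebra and its grading\<close>

definition End_B :: "(B \<Rightarrow> B) ring" where
  "End_B = \<lparr>carrier = {P. (\<forall>f g. P (f + g) = P f + P g) \<and> (\<forall>c f. P (cst c * f) = cst c * P f)},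
     mult = (\<circ>), one = id, zero = (\<lambda>_. 0), add = (\<lambda>P Q f. P f + Q f)\<rparr>"

definition scal :: "complex \<Rightarrow> B \<Rightarrow> B" where "scal c = (\<lambda>f. cst c * f)"

definition x1 :: "B \<Rightarrow> B" where "x1 = (\<lambda>f. X1 * f)"

definition x2 :: "B \<Rightarrow> B" where "x2 = (\<lambda>f. X2 * f)"

definition d1 :: "B \<Rightarrow> B" where "d1 = map_poly pderiv"

definition d2 :: "B \<Rightarrow> B" where "d2 = pderiv"

text \<open>The \<open>\<complex>\<close>-subalgebra of \<open>End_\<complex>(B)\<close> generated by a set of operators.\<close>

definition alg_gen :: "(B \<Rightarrow> B) set \<Rightarrow> (B \<Rightarrow> B) ring" where
  "alg_gen S = End_B\<lparr>carrier := generate_ring End_B (range scal \<union> S)\<rparr>"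

text \<open>The Weyl algebra acts faithfully on \<open>B\<close> (characteristic 0); we take it as the algebra of
  the corresponding differential operators.\<close>

definition D_B :: "(B \<Rightarrow> B) ring" where
  "D_B = alg_gen {x1, x2, d1, d2}"

text \<open>\<open>weyl_hom n P\<close>: the operator \<open>P\<close> lies in the degree \<open>n\<close> part of \<open>D_B\<close>, i.e. in the span of
  the words of degree \<open>n\<close> in the generators.\<close>

inductive weyl_hom :: "int \<Rightarrow> (B \<Rightarrow> B) \<Rightarrow> bool" where
  scal: "weyl_hom 0 (scal c)"
| x1: "weyl_hom 1 x1"
| x2: "weyl_hom 1 x2"
| d1: "weyl_hom (-1) d1"
| d2: "weyl_hom (-1) d2"
| add: "weyl_hom n P \<Longrightarrow> weyl_hom n Q \<Longrightarrow> weyl_hom n (P \<oplus>\<^bsub>End_B\<^esub> Q)"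
| mult: "weyl_hom m P \<Longrightarrow> weyl_hom n Q \<Longrightarrow> weyl_hom (m + n) (P \<otimes>\<^bsub>End_B\<^esub> Q)"


section \<open>The dihedral group and the invariant operators\<close>

definition eps :: "nat \<Rightarrow> complex" where
  "eps e = exp (2 * complex_of_real pi * \<i> / of_nat e)"

definition rho :: "nat \<Rightarrow> B \<Rightarrow> B" where
  "rho e = subst (cst (eps e) * X1) (cst (inverse (eps e)) * X2)"

definition sigma :: "B \<Rightarrow> B" where
  "sigma = subst X2 X1"

text \<open>The action on \<open>B\<close> is faithful, so the group is identified with its image.\<close>

definition dihedral :: "nat \<Rightarrow> (B \<Rightarrow> B) set" where
  "dihedral e = generate (BijGroup UNIV) {rho e, sigma}"

definition act :: "(B \<Rightarrow> B) \<Rightarrow> (B \<Rightarrow> B) \<Rightarrow> (B \<Rightarrow> B)" where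
  "act g P = (\<lambda>b. g (P (inv_into UNIV g b)))"

definition D_2 :: "nat \<Rightarrow> (B \<Rightarrow> B) ring" where
  "D_2 e = D_B\<lparr>carrier := {P \<in> carrier D_B. \<forall>g \<in> dihedral e. act g P = P}\<rparr>"

definition D_2_part :: "nat \<Rightarrow> int \<Rightarrow> (B \<Rightarrow> B) set" where
  "D_2_part e n = {P \<in> carrier (D_2 e). weyl_hom n P}"

definition D_2_0 :: "nat \<Rightarrow> (B \<Rightarrow> B) ring" where
  "D_2_0 e = (D_2 e)\<lparr>carrier := D_2_part e 0\<rparr>"

definition D_2_neg :: "nat \<Rightarrow> (B \<Rightarrow> B) set" where
  "D_2_neg e = generate (add_monoid (D_2 e)) (\<Union>n\<in>{..<0}. D_2_part e n)"


section \<open>The ring of invariants modulo lowering operators\<close>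

text \<open>\<^const>\<open>ideal_prod\<close> is the set of finite sums of products, for arbitrary subsets; as
  \<open>D_2 e\<close> is unital, this is the left ideal generated by \<open>D_2_neg e\<close>.\<close>

definition left_ideal :: "nat \<Rightarrow> (B \<Rightarrow> B) set" where
  "left_ideal e = ideal_prod (D_2 e) (carrier (D_2 e)) (D_2_neg e)"

definition I_2 :: "nat \<Rightarrow> (B \<Rightarrow> B) set" where
  "I_2 e = carrier (D_2_0 e) \<inter> left_ideal e"

definition R_2 :: "nat \<Rightarrow> (B \<Rightarrow> B) set ring" where
  "R_2 e = D_2_0 e Quot I_2 e"

definition cls :: "nat \<Rightarrow> (B \<Rightarrow> B) \<Rightarrow> (B \<Rightarrow> B) set" where
  "cls e P = I_2 e +>\<^bsub>D_2_0 e\<^esub> P"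

definition nabla :: "B \<Rightarrow> B" where
  "nabla = x1 \<otimes>\<^bsub>End_B\<^esub> d1 \<oplus>\<^bsub>End_B\<^esub> x2 \<otimes>\<^bsub>End_B\<^esub> d2"

definition C_nabla :: "(B \<Rightarrow> B) ring" where
  "C_nabla = alg_gen {nabla}"

definition Pi_2 :: "nat \<Rightarrow> (B \<Rightarrow> B) \<Rightarrow> (B \<Rightarrow> B) set" where
  "Pi_2 e = (\<lambda>P \<in> carrier C_nabla. cls e P)"

definition E_2 :: "nat \<Rightarrow> (B \<Rightarrow> B) set set" where
  "E_2 e = Pi_2 e ` carrier C_nabla"

definition w_2 :: "nat \<Rightarrow> B \<Rightarrow> B" where
  "w_2 k = (x1 \<otimes>\<^bsub>End_B\<^esub> d2) [^]\<^bsub>End_B\<^esub> k \<oplus>\<^bsub>End_B\<^esub> (x2 \<otimes>\<^bsub>End_B\<^esub> d1) [^]\<^bsub>End_B\<^esub> k"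


section \<open>Well-definedness\<close>

text \<open>
  \<open>dihedral\<close> consists of algebra automorphisms, \<open>I_2 e\<close> is a two-sided ideal of \<open>D_2_0 e\<close>,
  \<open>Pi_2 e\<close> is a ring homomorphism \<open>\<complex>[\<nabla>] \<rightarrow> R_2 e\<close>, and \<open>w_2 k\<close> lies in \<open>D_2_0 (2 * k)\<close>.
\<close>

subsection \<open>Algebra endomorphisms of B\<close>

lemma cst_simps [simp]:
  "cst 0 = 0" "cst 1 = 1" "cst (a + b) = cst a + cst b" "cst (a * b) = cst a * cst b"
  by (simp_all add: cst_def one_pCons)

lemma ev_hom:
  fixes h :: "'a::comm_ring_1 \<Rightarrow> 'b::comm_ring_1"
  assumes add: "\<And>x y. h (x + y) = h x + h y" and mult: "\<And>x y. h (x * y) = h x * h y"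
    and z: "h 0 = 0"
  shows "poly (map_poly h (p + q)) b = poly (map_poly h p) b + poly (map_poly h q) b" (is ?A)
    and "poly (map_poly h (p * q)) b = poly (map_poly h p) b * poly (map_poly h q) b" (is ?M)
    and "poly (map_poly h 0) b = 0"
proof -
  have a: "map_poly h (p + q) = map_poly h p + map_poly h q" for p q
    by (rule poly_eqI) (simp add: coeff_map_poly z add)
  show ?A by (simp add: a)
  have s: "map_poly h (Polynomial.smult c q) = Polynomial.smult (h c) (map_poly h q)" for c q
    by (rule poly_eqI) (simp add: coeff_map_poly z mult)
  have p: "map_poly h (pCons c q) = pCons (h c) (map_poly h q)" for c q
    by (rule poly_eqI) (simp add: coeff_map_poly z coeff_pCons split: nat.split)
  show ?M
    by (induction p) (simp_all add: p a s z algebra_simps)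
qed simp

lemma subst_hom:
  "subst a b (p + q) = subst a b p + subst a b q"
  "subst a b (p * q) = subst a b p * subst a b q"
  "subst a b 0 = 0"
  unfolding subst_def by (rule ev_hom; simp add: ev_hom)+

lemma subst_gens:
  "subst a b (cst c) = cst c" "subst a b X1 = a" "subst a b X2 = b" "subst a b 1 = 1"
  by (simp_all add: subst_def cst_def X1_def X2_def map_poly_pCons one_pCons)
    (simp_all flip: cst_def one_pCons)

definition alg_endo :: "(B \<Rightarrow> B) \<Rightarrow> bool" where
  "alg_endo f \<longleftrightarrow> (\<forall>p q. f (p + q) = f p + f q) \<and> (\<forall>p q. f (p * q) = f p * f q)
     \<and> (\<forall>c. f (cst c) = cst c)"

lemma alg_endo_ext:
  assumes f: "alg_endo f" and g: "alg_endo g" and "f X1 = g X1" "f X2 = g X2"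
  shows "f = g"
proof
  have z: "f 0 = 0" "g 0 = 0" using f g unfolding alg_endo_def by (metis cst_simps(1))+
  have 1: "f [:q:] = g [:q:]" for q
  proof (induction q)
    case (pCons a q)
    have "[:pCons a q:] = cst a + X1 * [:q:]" by (simp add: cst_def X1_def)
    then show ?case using f g assms(3) pCons unfolding alg_endo_def by metis
  qed (simp add: z)
  fix p show "f p = g p"
  proof (induction p)
    case (pCons a p)
    have "pCons a p = [:a:] + X2 * p" by (simp add: X2_def)
    then show ?case using f g assms(4) pCons 1 unfolding alg_endo_def by metis
  qed (simp add: z)
qed

lemma alg_endo_subst: "alg_endo (subst a b)"
  by (simp add: alg_endo_def subst_hom subst_gens)

lemma alg_endo_comp: "alg_endo f \<Longrightarrow> alg_endo g \<Longrightarrow> alg_endo (f \<circ> g)"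
  by (simp add: alg_endo_def)

lemma alg_endo_id: "alg_endo id"
  by (simp add: alg_endo_def)

lemma subst_id: assumes "subst a b c = X1" "subst a b d = X2" shows "subst a b \<circ> subst c d = id"
  by (rule alg_endo_ext) (auto simp: alg_endo_subst alg_endo_comp alg_endo_id assms subst_gens)

lemma eps_nz: "eps e \<noteq> 0" by (simp add: eps_def)

lemma cst_inv: "c \<noteq> 0 \<Longrightarrow> cst c * (cst (inverse c) * p) = p" "c \<noteq> 0 \<Longrightarrow> cst (inverse c) * (cst c * p) = p"
  by (simp_all flip: mult.assoc cst_simps(4))

lemma rho_bij: "bij (rho e)"
  unfolding rho_def
  by (rule o_bij[where g = "subst (cst (inverse (eps e)) * X1) (cst (eps e) * X2)"];
      rule subst_id; simp add: subst_hom subst_gens cst_inv eps_nz)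

lemma sigma_bij: "bij sigma"
  unfolding sigma_def by (rule o_bij[where g = "subst X2 X1"]; rule subst_id; simp add: subst_gens)

lemma Bij_UNIV: "Bij UNIV = {f. bij f}"
  by (auto simp: Bij_def)

lemma dihedral_aut:
  assumes "g \<in> dihedral e" shows "bij g \<and> alg_endo g"
  using assms unfolding dihedral_def
proof (induction rule: generate.induct)
  case one
  then show ?case using alg_endo_id by (simp add: BijGroup_def id_def bij_id[unfolded id_def])
next
  case (incl h)
  then show ?case using rho_bij sigma_bij
    by (auto simp: rho_def sigma_def alg_endo_subst)
next
  case (inv h)
  then have h: "bij h" "alg_endo h" using rho_bij sigma_bij
    by (auto simp: rho_def sigma_def alg_endo_subst)
  then have i: "inv\<^bsub>BijGroup UNIV\<^esub> h = inv_into UNIV h"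
    by (simp add: inv_BijGroup Bij_UNIV restrict_def)
  have "alg_endo (inv_into UNIV h)" unfolding alg_endo_def
    using h by (auto simp: alg_endo_def bij_is_surj bij_is_inj surj_f_inv_f intro!: inv_f_eq)
  then show ?case using h i bij_imp_bij_inv by auto
next
  case (eng h1 h2)
  then have "h1 \<otimes>\<^bsub>BijGroup UNIV\<^esub> h2 = h1 \<circ> h2"
    by (auto simp: BijGroup_def Bij_UNIV compose_def)
  with eng show ?case by (metis alg_endo_comp bij_comp)
qed

subsection \<open>The rings\<close>

lemma End_B_ring: "ring End_B"
proof (rule ringI)
  show "abelian_group End_B"
  proof (rule abelian_groupI)
    fix P assume "P \<in> carrier End_B"
    then show "\<exists>Q\<in>carrier End_B. Q \<oplus>\<^bsub>End_B\<^esub> P = \<zero>\<^bsub>End_B\<^esub>"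
      by (intro bexI[of _ "\<lambda>f. - P f"]) (auto simp: End_B_def)
  qed (auto simp: End_B_def algebra_simps)
  show "monoid End_B" by (rule monoidI) (auto simp: End_B_def)
qed (auto simp: End_B_def)

interpretation End: ring End_B by (rule End_B_ring)

lemma gens_End: "range scal \<union> {x1, x2, d1, d2} \<subseteq> carrier End_B"
proof -
  have "map_poly pderiv (cst c * f) = cst c * map_poly pderiv f" for c f
    by (rule poly_eqI) (simp add: cst_def coeff_map_poly pderiv_smult)
  moreover have "map_poly pderiv (f + g) = map_poly pderiv f + map_poly pderiv g" for f g :: B
    by (rule poly_eqI) (simp add: coeff_map_poly pderiv_add)
  ultimately show ?thesis
    by (auto simp: End_B_def scal_def x1_def x2_def d1_def d2_def algebra_simps pderiv_add)
      (simp_all add: cst_def pderiv_smult)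
qed

lemma D_B_subring: "subring (carrier D_B) End_B"
  using End.generate_ring_is_subring[OF gens_End] by (simp add: D_B_def alg_gen_def)

lemma weyl_hom_D_B: "weyl_hom n P \<Longrightarrow> P \<in> carrier D_B"
  by (induction rule: weyl_hom.induct)
    (auto simp: D_B_def alg_gen_def intro: generate_ring.intros)

lemma carrier_D_2:
  "carrier (D_2 e) = {P \<in> carrier D_B. \<forall>g \<in> dihedral e. \<forall>f. g (P f) = P (g f)}"
proof -
  have "act g P = P \<longleftrightarrow> (\<forall>f. g (P f) = P (g f))" if "g \<in> dihedral e" for g P
  proof -
    have "bij g" using dihedral_aut that by blast
    then show ?thesis unfolding act_def fun_eq_iff
      by (metis bij_inv_eq_iff)
  qed
  then show ?thesis by (auto simp: D_2_def)
qed

lemma uminus_End: "P \<in> carrier End_B \<Longrightarrow> \<ominus>\<^bsub>End_B\<^esub> P = scal (-1) \<otimes>\<^bsub>End_B\<^esub> P"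
proof (rule End.minus_equality)
  have m: "cst (-1) = -1" by (simp add: cst_def one_pCons)
  show "scal (-1) \<otimes>\<^bsub>End_B\<^esub> P \<oplus>\<^bsub>End_B\<^esub> P = \<zero>\<^bsub>End_B\<^esub>"
    by (auto simp: End_B_def scal_def m)
  assume P: "P \<in> carrier End_B"
  then show "P \<in> carrier End_B" .
  show "scal (-1) \<otimes>\<^bsub>End_B\<^esub> P \<in> carrier End_B"
    using P gens_End by (intro End.m_closed) auto
qed

lemma D_2_subring: "subring (carrier (D_2 e)) End_B"
proof -
  note D = subringE[OF D_B_subring]
  have a: "g (P f + Q f) = P (g f) + Q (g f)"
    if "g \<in> dihedral e" "\<forall>f. g (P f) = P (g f)" "\<forall>f. g (Q f) = Q (g f)" for g P Q f
    using dihedral_aut[OF that(1)] that(2,3) unfolding alg_endo_def by metis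
  have s: "g (cst c * P f) = cst c * P (g f)"
    if "g \<in> dihedral e" "\<forall>f. g (P f) = P (g f)" for g c P f
    using dihedral_aut[OF that(1)] that(2) unfolding alg_endo_def by metis
  show ?thesis
  proof (rule End.subringI)
    fix P assume P: "P \<in> carrier (D_2 e)"
    then have "\<ominus>\<^bsub>End_B\<^esub> P \<in> carrier D_B" "P \<in> carrier End_B"
      using D(1) D(5) by (auto simp: carrier_D_2)
    moreover have m: "(\<ominus>\<^bsub>End_B\<^esub> P) f = cst (-1) * P f" for f
      unfolding uminus_End[OF \<open>P \<in> carrier End_B\<close>] by (simp add: End_B_def scal_def)
    have "\<forall>f. g (P f) = P (g f)" if "g \<in> dihedral e" for g
      using P that by (simp add: carrier_D_2)
    then have "g ((\<ominus>\<^bsub>End_B\<^esub> P) f) = (\<ominus>\<^bsub>End_B\<^esub> P) (g f)" if "g \<in> dihedral e" for g f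
      unfolding m using that by (intro s)
    ultimately show "\<ominus>\<^bsub>End_B\<^esub> P \<in> carrier (D_2 e)"
      unfolding carrier_D_2 by blast
  next
    fix P Q assume P: "P \<in> carrier (D_2 e)" "Q \<in> carrier (D_2 e)"
    have m: "(P \<otimes>\<^bsub>End_B\<^esub> Q) f = P (Q f)" "(P \<oplus>\<^bsub>End_B\<^esub> Q) f = P f + Q f" for f
      by (simp_all add: End_B_def)
    have c: "\<forall>f. g (P f) = P (g f)" "\<forall>f. g (Q f) = Q (g f)" if "g \<in> dihedral e" for g
      using P that by (simp_all add: carrier_D_2)
    have "g ((P \<otimes>\<^bsub>End_B\<^esub> Q) f) = (P \<otimes>\<^bsub>End_B\<^esub> Q) (g f)"
      "g ((P \<oplus>\<^bsub>End_B\<^esub> Q) f) = (P \<oplus>\<^bsub>End_B\<^esub> Q) (g f)" if "g \<in> dihedral e" for g f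
      unfolding m using c[OF that] a[OF that] by auto
    then show "P \<otimes>\<^bsub>End_B\<^esub> Q \<in> carrier (D_2 e)" "P \<oplus>\<^bsub>End_B\<^esub> Q \<in> carrier (D_2 e)"
      using P D(6,7)[of P Q] unfolding carrier_D_2 by blast+
  next
    have "\<one>\<^bsub>End_B\<^esub> f = f" for f by (simp add: End_B_def)
    then show "\<one>\<^bsub>End_B\<^esub> \<in> carrier (D_2 e)"
      using D(3) unfolding carrier_D_2 by simp
  next
    show "carrier (D_2 e) \<subseteq> carrier End_B" using D(1) by (auto simp: carrier_D_2)
  qed
qed

lemma weyl_hom_uminus: "weyl_hom n P \<Longrightarrow> weyl_hom n (\<ominus>\<^bsub>End_B\<^esub> P)"
  using weyl_hom.mult[OF weyl_hom.scal[of "-1"]] subringE(1)[OF D_B_subring] weyl_hom_D_B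
  by (auto simp: uminus_End subset_iff)

lemma scal_1: "scal 1 = \<one>\<^bsub>End_B\<^esub>"
  by (auto simp: scal_def End_B_def)

lemma carrier_D_2_0: "carrier (D_2_0 e) = {P \<in> carrier (D_2 e). weyl_hom 0 P}"
  by (simp add: D_2_0_def D_2_part_def)

lemma D_2_0_subring: "subring (carrier (D_2_0 e)) End_B"
proof -
  note D = subringE[OF D_2_subring[of e]]
  show ?thesis
  proof (rule End.subringI)
    show "\<one>\<^bsub>End_B\<^esub> \<in> carrier (D_2_0 e)"
      using D(3) weyl_hom.scal[of 1] by (simp add: carrier_D_2_0 scal_1)
    show "carrier (D_2_0 e) \<subseteq> carrier End_B"
      using D(1) by (auto simp: carrier_D_2_0)
  next
    fix P Q assume "P \<in> carrier (D_2_0 e)" "Q \<in> carrier (D_2_0 e)"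
    then show "P \<otimes>\<^bsub>End_B\<^esub> Q \<in> carrier (D_2_0 e)" "P \<oplus>\<^bsub>End_B\<^esub> Q \<in> carrier (D_2_0 e)"
      using D(6,7)[of P Q] weyl_hom.mult[of 0 P 0 Q] weyl_hom.add[of 0 P Q]
      unfolding carrier_D_2_0 by simp_all
  next
    fix P assume "P \<in> carrier (D_2_0 e)"
    then show "\<ominus>\<^bsub>End_B\<^esub> P \<in> carrier (D_2_0 e)"
      using D(5)[of P] weyl_hom_uminus[of 0 P] unfolding carrier_D_2_0 by simp
  qed
qed

lemma alg_gen_ops [simp]:
  "mult (alg_gen S) = mult End_B" "add (alg_gen S) = add End_B" "one (alg_gen S) = one End_B"
  "zero (alg_gen S) = zero End_B"
  by (simp_all add: alg_gen_def)

lemma D_2_ops [simp]: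
  "mult (D_2 e) = mult End_B" "add (D_2 e) = add End_B" "one (D_2 e) = one End_B"
  "zero (D_2 e) = zero End_B"
  by (simp_all add: D_2_def D_B_def)

lemma D_2_0_ops [simp]:
  "mult (D_2_0 e) = mult End_B" "add (D_2_0 e) = add End_B" "one (D_2_0 e) = one End_B"
  "zero (D_2_0 e) = zero End_B"
  by (simp_all add: D_2_0_def)

lemma D_2_alt: "D_2 e = End_B\<lparr>carrier := carrier (D_2 e)\<rparr>"
  by (simp add: D_2_def D_B_def alg_gen_def)

lemma D_2_0_alt: "D_2_0 e = End_B\<lparr>carrier := carrier (D_2_0 e)\<rparr>"
  by (simp add: D_2_0_def D_2_def D_B_def alg_gen_def)

lemma D_2_ring: "ring (D_2 e)"
  using End.subring_is_ring[OF D_2_subring[of e]] D_2_alt by metis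

lemma D_2_0_ring: "ring (D_2_0 e)"
  using End.subring_is_ring[OF D_2_0_subring[of e]] D_2_0_alt by metis

lemma D_2_0_sub: "carrier (D_2_0 e) \<subseteq> carrier (D_2 e)"
  by (auto simp: carrier_D_2_0)

lemma D_2_neg_closed:
  shows "D_2_neg e \<subseteq> carrier (D_2 e)" "\<zero>\<^bsub>D_2 e\<^esub> \<in> D_2_neg e"
    and "P \<in> D_2_neg e \<Longrightarrow> Q \<in> carrier (D_2_0 e) \<Longrightarrow> P \<otimes>\<^bsub>D_2 e\<^esub> Q \<in> D_2_neg e"
proof -
  interpret ring "D_2 e" by (rule D_2_ring)
  let ?U = "\<Union>n\<in>{..<0}. D_2_part e n"
  have U: "?U \<subseteq> carrier (D_2 e)" by (auto simp: D_2_part_def)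
  show c: "D_2_neg e \<subseteq> carrier (D_2 e)"
    using add.generate_incl[OF U] by (simp add: D_2_neg_def)
  show "\<zero>\<^bsub>D_2 e\<^esub> \<in> D_2_neg e"
    using generate.one[of "add_monoid (D_2 e)" ?U] by (simp add: D_2_neg_def)
  assume Q: "Q \<in> carrier (D_2_0 e)"
  then have Q2: "Q \<in> carrier (D_2 e)" using D_2_0_sub by blast
  have mU: "h \<otimes>\<^bsub>D_2 e\<^esub> Q \<in> ?U" if "h \<in> ?U" for h
  proof -
    from that obtain n where n: "n < 0" "h \<in> carrier (D_2 e)" "weyl_hom n h"
      by (auto simp: D_2_part_def)
    moreover have "weyl_hom n (h \<otimes>\<^bsub>End_B\<^esub> Q)"
      using weyl_hom.mult[OF n(3), of 0 Q] Q by (simp add: carrier_D_2_0)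
    ultimately show ?thesis
      using m_closed[OF n(2) Q2] by (auto simp: D_2_part_def)
  qed
  assume "P \<in> D_2_neg e"
  then show "P \<otimes>\<^bsub>D_2 e\<^esub> Q \<in> D_2_neg e" unfolding D_2_neg_def
  proof (induction rule: generate.induct)
    case one
    then show ?case
      using generate.one[of "add_monoid (D_2 e)" ?U] l_null[OF Q2] by simp
  next
    case (incl h)
    then show ?case using mU by (intro generate.incl) blast
  next
    case (inv h)
    then have "h \<in> carrier (D_2 e)" using U by auto
    then have "(inv\<^bsub>add_monoid (D_2 e)\<^esub> h) \<otimes>\<^bsub>D_2 e\<^esub> Q = inv\<^bsub>add_monoid (D_2 e)\<^esub> (h \<otimes>\<^bsub>D_2 e\<^esub> Q)"
      using l_minus[OF _ Q2] by (simp add: a_inv_def)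
    then show ?case using mU[OF inv] generate.inv by metis
  next
    case (eng h1 h2)
    then have "h1 \<in> carrier (D_2 e)" "h2 \<in> carrier (D_2 e)"
      using c by (auto simp: D_2_neg_def)
    then have "(h1 \<otimes>\<^bsub>add_monoid (D_2 e)\<^esub> h2) \<otimes>\<^bsub>D_2 e\<^esub> Q
        = (h1 \<otimes>\<^bsub>D_2 e\<^esub> Q) \<otimes>\<^bsub>add_monoid (D_2 e)\<^esub> (h2 \<otimes>\<^bsub>D_2 e\<^esub> Q)"
      using l_distr[OF _ _ Q2] by simp
    then show ?case using eng.IH generate.eng by metis
  qed
qed

lemma left_ideal_closed:
  shows "left_ideal e \<subseteq> carrier (D_2 e)" "\<zero>\<^bsub>D_2 e\<^esub> \<in> left_ideal e"
    and "P \<in> left_ideal e \<Longrightarrow> Q \<in> left_ideal e \<Longrightarrow> P \<oplus>\<^bsub>D_2 e\<^esub> Q \<in> left_ideal e"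
    and "P \<in> left_ideal e \<Longrightarrow> Q \<in> carrier (D_2 e) \<Longrightarrow> Q \<otimes>\<^bsub>D_2 e\<^esub> P \<in> left_ideal e"
    and "P \<in> left_ideal e \<Longrightarrow> Q \<in> carrier (D_2_0 e) \<Longrightarrow> P \<otimes>\<^bsub>D_2 e\<^esub> Q \<in> left_ideal e"
proof -
  interpret ring "D_2 e" by (rule D_2_ring)
  note N = D_2_neg_closed[where e = e]
  show c: "left_ideal e \<subseteq> carrier (D_2 e)"
  proof
    fix P assume "P \<in> left_ideal e"
    then show "P \<in> carrier (D_2 e)" unfolding left_ideal_def
    proof (induction rule: ideal_prod.induct)
      case (prod i j)
      then show ?case using m_closed[of i j] N(1) by blast
    next
      case (sum s t)
      then show ?case by (intro a_closed)
    qed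
  qed
  have c': "P \<in> carrier (D_2 e)" if "P \<in> ideal_prod (D_2 e) (carrier (D_2 e)) (D_2_neg e)" for P
    using c that by (auto simp: left_ideal_def)
  show "\<zero>\<^bsub>D_2 e\<^esub> \<in> left_ideal e"
    using ideal_prod.prod[OF zero_closed N(2)] l_null[OF zero_closed]
    by (metis left_ideal_def)
  show "P \<in> left_ideal e \<Longrightarrow> Q \<in> left_ideal e \<Longrightarrow> P \<oplus>\<^bsub>D_2 e\<^esub> Q \<in> left_ideal e"
    unfolding left_ideal_def by (rule ideal_prod.sum)
  show "Q \<otimes>\<^bsub>D_2 e\<^esub> P \<in> left_ideal e" if "P \<in> left_ideal e" and Q: "Q \<in> carrier (D_2 e)"
    using that(1) unfolding left_ideal_def
  proof (induction rule: ideal_prod.induct)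
    case (prod i j)
    then show ?case
      using ideal_prod.prod[OF m_closed[OF Q prod(1)] prod(2), of "D_2 e"]
        m_assoc[OF Q prod(1) subsetD[OF N(1) prod(2)]] by simp
  next
    case (sum s t)
    show ?case
      using ideal_prod.sum[OF sum.IH] r_distr[OF c'[OF sum.hyps(1)] c'[OF sum.hyps(2)] Q] by simp
  qed
  show "P \<otimes>\<^bsub>D_2 e\<^esub> Q \<in> left_ideal e" if "P \<in> left_ideal e" and Q: "Q \<in> carrier (D_2_0 e)"
    using that(1) unfolding left_ideal_def
  proof (induction rule: ideal_prod.induct)
    case (prod i j)
    then show ?case
      using ideal_prod.prod[OF prod(1) N(3)[OF prod(2) Q], of "D_2 e"]
        m_assoc[OF prod(1) subsetD[OF N(1) prod(2)] subsetD[OF D_2_0_sub Q]] by simp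
  next
    case (sum s t)
    show ?case
      using ideal_prod.sum[OF sum.IH]
        l_distr[OF c'[OF sum.hyps(1)] c'[OF sum.hyps(2)] subsetD[OF D_2_0_sub Q]] by simp
  qed
qed

lemma I_2_ideal: "ideal (I_2 e) (D_2_0 e)"
proof -
  interpret ring "D_2_0 e" by (rule D_2_0_ring)
  note L = left_ideal_closed[where e = e, simplified] and S = subsetD[OF D_2_0_sub[of e]]
  have m: "P \<in> I_2 e \<Longrightarrow> Q \<in> carrier (D_2_0 e) \<Longrightarrow> Q \<otimes>\<^bsub>D_2_0 e\<^esub> P \<in> I_2 e" for P Q
    using L(4)[of P Q] S m_closed[of Q P] by (simp add: I_2_def)
  show ?thesis
  proof (rule idealI)
    show "ring (D_2_0 e)" by (rule D_2_0_ring)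
    show "subgroup (I_2 e) (add_monoid (D_2_0 e))"
    proof (rule add.subgroupI)
      show "I_2 e \<subseteq> carrier (D_2_0 e)" by (auto simp: I_2_def)
      show "I_2 e \<noteq> {}" using L(2) zero_closed by (auto simp: I_2_def)
      fix P Q assume P: "P \<in> I_2 e"
      have "\<ominus>\<^bsub>D_2_0 e\<^esub> P = (\<ominus>\<^bsub>D_2_0 e\<^esub> \<one>\<^bsub>D_2_0 e\<^esub>) \<otimes>\<^bsub>D_2_0 e\<^esub> P"
        using P l_minus[OF one_closed, of P] l_one[of P] by (simp add: I_2_def)
      then show "\<ominus>\<^bsub>D_2_0 e\<^esub> P \<in> I_2 e"
        using m[OF P, of "\<ominus>\<^bsub>D_2_0 e\<^esub> \<one>\<^bsub>D_2_0 e\<^esub>"] by (metis a_inv_closed one_closed)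
      assume "Q \<in> I_2 e"
      then show "P \<oplus>\<^bsub>D_2_0 e\<^esub> Q \<in> I_2 e"
        using P L(3)[of P Q] a_closed[of P Q] by (simp add: I_2_def)
    qed
    fix P Q assume "P \<in> I_2 e" "Q \<in> carrier (D_2_0 e)"
    then show "Q \<otimes>\<^bsub>D_2_0 e\<^esub> P \<in> I_2 e" "P \<otimes>\<^bsub>D_2_0 e\<^esub> Q \<in> I_2 e"
      using m L(5)[of P Q] m_closed[of P Q] by (simp_all add: I_2_def)
  qed
qed

subsection \<open>The homomorphism and the extra generator\<close>

definition twisted_der :: "(B \<Rightarrow> B) \<Rightarrow> (B \<Rightarrow> B) \<Rightarrow> bool" where
  "twisted_der f D \<longleftrightarrow> (\<forall>p q. D (p + q) = D p + D q) \<and> (\<forall>p q. D (p * q) = D p * f q + f p * D q)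
     \<and> (\<forall>c. D (cst c) = 0)"

lemma twisted_der_ext:
  assumes f: "twisted_der f D" and g: "twisted_der f E" and "D X1 = E X1" "D X2 = E X2"
  shows "D p = E p"
proof -
  have z: "D 0 = 0" "E 0 = 0" using f g unfolding twisted_der_def by (metis cst_simps(1))+
  have 1: "D [:q:] = E [:q:]" for q
  proof (induction q)
    case (pCons a q)
    have "[:pCons a q:] = cst a + X1 * [:q:]" by (simp add: cst_def X1_def)
    then show ?case using f g assms(3) pCons unfolding twisted_der_def by metis
  qed (simp add: z)
  show "D p = E p"
  proof (induction p)
    case (pCons a p)
    have "pCons a p = [:a:] + X2 * p" by (simp add: X2_def)
    then show ?case using f g assms(4) pCons 1 unfolding twisted_der_def by metis
  qed (simp add: z)
qed

lemma d1_der: "d1 (p + q) = d1 p + d1 q" "d1 (p * q) = d1 p * q + p * d1 q"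
proof -
  have a: "d1 (p + q) = d1 p + d1 q" for p q
    by (rule poly_eqI) (simp add: d1_def coeff_map_poly pderiv_add)
  then show "d1 (p + q) = d1 p + d1 q" .
  have s: "d1 (Polynomial.smult c q) = Polynomial.smult (pderiv c) q + Polynomial.smult c (d1 q)" for c q
    by (rule poly_eqI) (simp add: d1_def coeff_map_poly pderiv_mult algebra_simps)
  have p: "d1 (pCons c q) = pCons (pderiv c) (d1 q)" for c q
    by (simp add: d1_def map_poly_pCons)
  have "d1 0 = 0" by (simp add: d1_def)
  then show "d1 (p * q) = d1 p * q + p * d1 q"
    by (induction p) (simp_all add: p a s algebra_simps)
qed

lemma d2_der: "d2 (p + q) = d2 p + d2 q" "d2 (p * q) = d2 p * q + p * d2 q"
  by (simp_all add: d2_def pderiv_add pderiv_mult algebra_simps)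

lemma d_gens [simp]:
  "d1 (cst c) = 0" "d2 (cst c) = 0" "d1 X1 = 1" "d1 X2 = 0" "d2 X1 = 0" "d2 X2 = 1"
  by (simp_all add: d1_def d2_def cst_def X1_def X2_def map_poly_pCons pderiv_pCons one_pCons)

lemma rho_gens: "rho e (cst c) = cst c" "rho e X1 = cst (eps e) * X1"
  "rho e X2 = cst (inverse (eps e)) * X2" "rho e 0 = 0" "rho e 1 = 1"
  "rho e (p + q) = rho e p + rho e q" "rho e (p * q) = rho e p * rho e q"
  by (simp_all add: rho_def subst_hom subst_gens)

lemma sigma_gens: "sigma (cst c) = cst c" "sigma X1 = X2" "sigma X2 = X1" "sigma 0 = 0" "sigma 1 = 1"
  "sigma (p + q) = sigma p + sigma q" "sigma (p * q) = sigma p * sigma q"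
  by (simp_all add: sigma_def subst_hom subst_gens)

lemma d_rho: "d1 (rho e p) = cst (eps e) * rho e (d1 p)"
  "d2 (rho e p) = cst (inverse (eps e)) * rho e (d2 p)"
  by (rule twisted_der_ext[where f = "rho e"];
      simp add: twisted_der_def rho_gens d1_der d2_der; simp add: algebra_simps)+

lemma d_sigma: "d1 (sigma p) = sigma (d2 p)" "d2 (sigma p) = sigma (d1 p)"
  by (rule twisted_der_ext[where f = sigma];
      simp add: twisted_der_def sigma_gens d1_der d2_der; simp add: algebra_simps)+

lemma commute_dihedral:
  assumes "g \<in> dihedral e"
    and rho: "\<And>f. rho e (P f) = P (rho e f)" and sigma: "\<And>f. sigma (P f) = P (sigma f)"
  shows "g (P f) = P (g f)"
  using assms(1) unfolding dihedral_def
proof (induction arbitrary: f rule: generate.induct)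
  case one
  then show ?case by (simp add: BijGroup_def)
next
  case (incl h)
  then show ?case using rho sigma by auto
next
  case (inv h)
  then have h: "bij h" "\<And>f. h (P f) = P (h f)" using rho_bij sigma_bij rho sigma by auto
  then have i: "inv\<^bsub>BijGroup UNIV\<^esub> h = inv_into UNIV h"
    by (simp add: inv_BijGroup Bij_UNIV restrict_def)
  show ?case unfolding i using h by (metis bij_inv_eq_iff)
next
  case (eng h1 h2)
  then have "bij h1" "bij h2" using dihedral_aut by (auto simp: dihedral_def)
  then have "h1 \<otimes>\<^bsub>BijGroup UNIV\<^esub> h2 = h1 \<circ> h2"
    by (auto simp: BijGroup_def Bij_UNIV compose_def)
  with eng.IH show ?case by simp
qed

lemma D_2_0_I:
  assumes "weyl_hom 0 P" "\<And>f. rho e (P f) = P (rho e f)" "\<And>f. sigma (P f) = P (sigma f)"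
  shows "P \<in> carrier (D_2_0 e)"
  using assms commute_dihedral weyl_hom_D_B unfolding carrier_D_2_0 carrier_D_2 by blast

lemma scal_D_2_0: "scal c \<in> carrier (D_2_0 e)"
  by (rule D_2_0_I) (simp_all add: scal rho_gens sigma_gens scal_def weyl_hom.scal[unfolded scal_def])

lemma nabla_D_2_0: "nabla \<in> carrier (D_2_0 e)"
proof (rule D_2_0_I)
  show "weyl_hom 0 nabla"
    using weyl_hom.mult[OF weyl_hom.x1 weyl_hom.d1] weyl_hom.mult[OF weyl_hom.x2 weyl_hom.d2]
    by (simp add: nabla_def weyl_hom.add)
  have n: "nabla f = X1 * d1 f + X2 * d2 f" for f
    by (simp add: nabla_def End_B_def x1_def x2_def)
  show "rho e (nabla f) = nabla (rho e f)" for f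
    by (simp add: n rho_gens d_rho algebra_simps)
  show "sigma (nabla f) = nabla (sigma f)" for f
    by (simp add: n sigma_gens d_sigma)
qed

lemma C_nabla_sub: "carrier C_nabla \<subseteq> carrier (D_2_0 e)"
  unfolding C_nabla_def alg_gen_def
  using End.generate_ring_min_subring1[OF _ D_2_0_subring[of e], of "range scal \<union> {nabla}"]
    scal_D_2_0 nabla_D_2_0 subringE(1)[OF D_2_0_subring[of e]] by auto

lemma Pi_2_hom: "Pi_2 e \<in> ring_hom C_nabla (R_2 e)"
proof -
  have "nabla \<in> carrier End_B"
    using nabla_D_2_0 subringE(1)[OF D_2_0_subring] by blast
  then have g: "range scal \<union> {nabla} \<subseteq> carrier End_B" using gens_End by auto
  have s: "subring (carrier C_nabla) End_B"
    using End.generate_ring_is_subring[OF g] by (simp add: C_nabla_def alg_gen_def)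
  have c: "cls e \<in> ring_hom (D_2_0 e) (R_2 e)"
    using ideal.rcos_ring_hom[OF I_2_ideal] by (simp add: R_2_def cls_def[abs_def])
  note S = subsetD[OF C_nabla_sub[of e]]
  have ops: "mult C_nabla = mult End_B" "add C_nabla = add End_B" "one C_nabla = one End_B"
    by (simp_all add: C_nabla_def)
  show ?thesis
  proof (rule ring_hom_memI)
    fix x assume x: "x \<in> carrier C_nabla"
    then show "Pi_2 e x \<in> carrier (R_2 e)"
      using ring_hom_closed[OF c S] by (simp add: Pi_2_def)
    fix y assume y: "y \<in> carrier C_nabla"
    show "Pi_2 e (x \<otimes>\<^bsub>C_nabla\<^esub> y) = Pi_2 e x \<otimes>\<^bsub>R_2 e\<^esub> Pi_2 e y"
      using subringE(6)[OF s x y] x y ring_hom_mult[OF c S[OF x] S[OF y]] by (simp add: Pi_2_def ops)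
    show "Pi_2 e (x \<oplus>\<^bsub>C_nabla\<^esub> y) = Pi_2 e x \<oplus>\<^bsub>R_2 e\<^esub> Pi_2 e y"
      using subringE(7)[OF s x y] x y ring_hom_add[OF c S[OF x] S[OF y]] by (simp add: Pi_2_def ops)
  next
    show "Pi_2 e \<one>\<^bsub>C_nabla\<^esub> = \<one>\<^bsub>R_2 e\<^esub>"
      using subringE(3)[OF s] ring_hom_one[OF c] by (simp add: Pi_2_def ops)
  qed
qed

lemma eps_power:
  assumes "e \<ge> 1" shows "eps e ^ e = 1"
proof -
  have "eps e ^ e = exp (of_nat e * (2 * complex_of_real pi * \<i> / of_nat e))"
    unfolding eps_def by (rule exp_of_nat_mult[symmetric])
  also have "\<dots> = 1" using assms exp_two_pi_i by simp
  finally show ?thesis .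
qed

lemma w_2_D_2_0:
  assumes "e \<ge> 1" "e = 2 * k" shows "w_2 k \<in> carrier (D_2_0 e)"
proof (rule D_2_0_I)
  let ?P = "x1 \<otimes>\<^bsub>End_B\<^esub> d2" and ?Q = "x2 \<otimes>\<^bsub>End_B\<^esub> d1"
  have P: "weyl_hom 0 ?P" "weyl_hom 0 ?Q"
    using weyl_hom.mult[OF weyl_hom.x1 weyl_hom.d2] weyl_hom.mult[OF weyl_hom.x2 weyl_hom.d1]
    by simp_all
  have Pk: "weyl_hom 0 (R [^]\<^bsub>End_B\<^esub> n)" if "weyl_hom 0 R" for R and n :: nat
  proof (induction n)
    case 0
    then show ?case using weyl_hom.scal[of 1] by (simp add: scal_1)
  next
    case (Suc n)
    then show ?case using weyl_hom.mult[OF Suc that] by simp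
  qed
  show "weyl_hom 0 (w_2 k)"
    unfolding w_2_def by (intro weyl_hom.add Pk P)
  have one: "\<one>\<^bsub>End_B\<^esub> f = f" and "(R \<otimes>\<^bsub>End_B\<^esub> S) f = R (S f)" for R S f
    by (simp_all add: End_B_def)
  then have pow: "(R [^]\<^bsub>End_B\<^esub> (0::nat)) f = f"
    "(R [^]\<^bsub>End_B\<^esub> Suc n) f = (R [^]\<^bsub>End_B\<^esub> n) (R f)" for R f n
    by (simp_all only: nat_pow_0 nat_pow_Suc)
  have app: "?P f = X1 * d2 f" "?Q f = X2 * d1 f" "w_2 n f = (?P [^]\<^bsub>End_B\<^esub> n) f + (?Q [^]\<^bsub>End_B\<^esub> n) f" for f n
    by (simp_all add: End_B_def x1_def x2_def w_2_def)
  let ?c = "eps e ^ 2"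
  have r: "rho e (?P f) = cst ?c * ?P (rho e f)" "rho e (?Q f) = cst (inverse ?c) * ?Q (rho e f)" for f
    by (simp_all add: app rho_gens d_rho power2_eq_square cst_inv eps_nz algebra_simps)
  have lin: "R (cst a * f) = cst a * R f" if "weyl_hom 0 R" for R a f
    using weyl_hom_D_B[OF that] subringE(1)[OF D_B_subring] by (auto simp: End_B_def)
  have rk: "rho e ((R [^]\<^bsub>End_B\<^esub> n) f) = cst (a ^ n) * (R [^]\<^bsub>End_B\<^esub> n) (rho e f)"
    if "\<And>f. rho e (R f) = cst a * R (rho e f)" "weyl_hom 0 R" for R a f and n :: nat
  proof (induction n arbitrary: f)
    case (Suc n)
    show ?case unfolding pow Suc that(1) lin[OF Pk[OF that(2)]] by (simp add: algebra_simps)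
  qed (simp add: one)
  have c: "?c ^ k = 1"
    using eps_power[OF assms(1)] assms(2) by (simp add: power_mult)
  then have "inverse ?c ^ k = 1" by (simp only: power_inverse inverse_1)
  with c show "rho e (w_2 k f) = w_2 k (rho e f)" for f
    using rk[OF r(1) P(1)] rk[OF r(2) P(2)] by (simp add: app rho_gens)
  have s: "sigma ((?P [^]\<^bsub>End_B\<^esub> n) f) = (?Q [^]\<^bsub>End_B\<^esub> n) (sigma f)"
    "sigma ((?Q [^]\<^bsub>End_B\<^esub> n) f) = (?P [^]\<^bsub>End_B\<^esub> n) (sigma f)" for n :: nat and f
    by (induction n arbitrary: f) (simp_all only: pow, simp_all add: one app sigma_gens d_sigma)
  show "sigma (w_2 k f) = w_2 k (sigma f)" for f
    by (simp add: app sigma_gens s)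
qed

end

theory Submission
  imports Defs "HOL-Number_Theory.Cong"
begin

text \<open>
  Write \<open>J\<close> for the left ideal generated by the invariant operators of negative degree. Averaging a
  normally ordered expression over the group shows that the invariants of degree \<open>0\<close> are spanned by
  the symmetrised monomials \<open>x\<^sub>1^a x\<^sub>2^b \<partial>\<^sub>1^c \<partial>\<^sub>2^d + x\<^sub>1^b x\<^sub>2^a \<partial>\<^sub>1^d \<partial>\<^sub>2^c\<close> with \<open>a + b = c + d\<close> and
  \<open>a + d \<equiv> b + c\<close> modulo \<open>e\<close> (\<open>D_2_part_induct\<close>). Two lowering operators, \<open>\<partial>\<^sub>1\<partial>\<^sub>2\<close> and
  \<open>\<partial>\<^sub>1^e + \<partial>\<^sub>2^e\<close>, suffice to reduce these.
  
  If \<open>c\<close> and \<open>d\<close> are both positive, \<open>\<partial>\<^sub>1\<partial>\<^sub>2\<close> splits off on the right and the element is in \<open>J\<close>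
  (\<open>sym_mon_mixed_in_I_2\<close>). Otherwise one may take \<open>d = 0\<close>, so that \<open>c = a + b\<close> and \<open>e\<close> divides \<open>2 * b\<close>.
  Multiplication by \<open>\<nabla> - c\<close> raises \<open>a\<close> and \<open>c\<close> by one modulo \<open>J\<close> as soon as \<open>c > 0\<close>
  (\<open>sym_mon_raise\<close>). For \<open>b = 0\<close> this produces everything from \<open>1\<close> and \<open>\<nabla>\<close>. For \<open>b \<ge> e\<close> the second
  lowering operator splits off and leaves a polynomial in \<open>\<nabla>\<close>. The remaining possibility \<open>0 < b < e\<close>
  forces \<open>e = 2 * b\<close>, so it does not arise for odd \<open>e\<close>, and for even \<open>e\<close> it is the chain generated
  from \<open>w_2 b\<close>, the case \<open>a = 0\<close>. This gives both generation statements (\<open>sym_mon_nabla_span\<close>).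
  Since \<open>\<nabla>\<close> commutes with all operators of degree \<open>0\<close>, a ring generated over its polynomials by one
  further element is commutative.
  
  For \<open>e = 2 * k\<close>, the class of \<open>w_2 k\<close> is recognised by its action on \<open>x\<^sub>1^k\<close>. Comparing degrees and
  \<open>\<rho>\<close>-eigenvalues, invariant operators of negative degree annihilate \<open>x\<^sub>1^k\<close> (\<open>lowering_kills\<close>), hence
  so does \<open>J\<close>. A polynomial in \<open>\<nabla>\<close> multiplies \<open>x\<^sub>1^k\<close> by a scalar, whereas \<open>w_2 k\<close> sends it to
  \<open>k! x\<^sub>2^k\<close> (\<open>w_2_not_nabla\<close>).
\<close>

section \<open>Linear operators on the polynomial ring\<close>

lemma End_ops:
  "P \<otimes>\<^bsub>End_B\<^esub> Q = (\<lambda>f. P (Q f))" "P \<oplus>\<^bsub>End_B\<^esub> Q = (\<lambda>f. P f + Q f)"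
  "\<one>\<^bsub>End_B\<^esub> = (\<lambda>f. f)" "\<zero>\<^bsub>End_B\<^esub> = (\<lambda>f. 0)"
  by (auto simp: End_B_def)

lemma cst_power: "cst (a ^ n) = cst a ^ n"
  by (induction n) simp_all

lemma cst_of_nat: "cst (of_nat n) = of_nat n"
  by (induction n) simp_all

lemma cst_sum: "cst (sum h A) = (\<Sum>i\<in>A. cst (h i))"
  by (induction A rule: infinite_finite_induct) simp_all

lemma cst_uminus: "cst (- a) = - cst a"
  by (simp add: cst_def)

lemma cst_of_int: "cst (of_int n) = of_int n"
  by (cases n) (simp_all add: cst_of_nat cst_uminus flip: of_nat_Suc)

lemma End_linear:
  assumes "P \<in> carrier End_B"
  shows "P (f + g) = P f + P g" "P (cst c * f) = cst c * P f" "P 0 = 0"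
proof -
  show a: "P (f + g) = P f + P g" "P (cst c * f) = cst c * P f" for f g c
    using assms by (auto simp: End_B_def)
  show "P 0 = 0" using a(2)[of 0 0] by simp
qed

lemma d_comm: "d1 (d2 f) = d2 (d1 f)"
  by (rule poly_eqI) (simp add: d1_def d2_def coeff_map_poly coeff_pderiv pderiv_mult of_nat_poly pderiv_pCons pderiv_smult)

lemma d_cst: "d1 (cst c * f) = cst c * d1 f" "d2 (cst c * f) = cst c * d2 f"
  by (simp_all add: d1_der d2_der)

lemma d_zero: "d1 0 = 0" "d2 0 = 0" "d1 1 = 0" "d2 1 = 0"
  using d_gens(1,2)[of 0] d_gens(1,2)[of 1] by simp_all

text \<open>
  The exponents on the right truncate at \<open>0\<close>, where the coefficient in front of them vanishes.
\<close>

lemma d_X_power: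
  "d1 (X1 ^ a * f) = of_nat a * X1 ^ (a - 1) * f + X1 ^ a * d1 f"
  "d1 (X2 ^ b * f) = X2 ^ b * d1 f"
  "d2 (X2 ^ b * f) = of_nat b * X2 ^ (b - 1) * f + X2 ^ b * d2 f"
  "d2 (X1 ^ a * f) = X1 ^ a * d2 f"
proof -
  have *: "d1 (X1 ^ a) = of_nat a * X1 ^ (a - 1)" "d2 (X2 ^ a) = of_nat a * X2 ^ (a - 1)" for a
    by (induction a; simp add: d_zero d1_der d2_der; case_tac a; simp add: algebra_simps)+
  have z: "d1 (X2 ^ b) = 0" "d2 (X1 ^ b) = 0" for b
    by (induction b; simp add: d_zero d1_der d2_der)+
  show "d1 (X1 ^ a * f) = of_nat a * X1 ^ (a - 1) * f + X1 ^ a * d1 f"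
  "d1 (X2 ^ b * f) = X2 ^ b * d1 f"
  "d2 (X2 ^ b * f) = of_nat b * X2 ^ (b - 1) * f + X2 ^ b * d2 f"
  "d2 (X1 ^ a * f) = X1 ^ a * d2 f"
    by (simp_all add: d1_der d2_der * z)
qed

section \<open>Normally ordered monomials\<close>

definition mon :: "nat \<Rightarrow> nat \<Rightarrow> nat \<Rightarrow> nat \<Rightarrow> B \<Rightarrow> B" where
  "mon a b c d = (\<lambda>f. X1 ^ a * X2 ^ b * (d1 ^^ c) ((d2 ^^ d) f))"

text \<open>
  Conjugation by \<open>\<sigma>\<close> exchanges the indices 1 and 2, so this is the trace of a monomial over
  \<open>\<langle>\<sigma>\<rangle>\<close>.
\<close>

definition sym_mon :: "nat \<Rightarrow> nat \<Rightarrow> nat \<Rightarrow> nat \<Rightarrow> B \<Rightarrow> B" where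
  "sym_mon a b c d = (\<lambda>f. mon a b c d f + mon b a d c f)"

lemma sym_mon_swap: "sym_mon a b c d = sym_mon b a d c"
  by (simp add: sym_mon_def add.commute)

lemma d_pow_comm: "d1 ((d2 ^^ d) f) = (d2 ^^ d) (d1 f)" "(d1 ^^ c) (d2 f) = d2 ((d1 ^^ c) f)"
   "(d1 ^^ c) ((d2 ^^ d) f) = (d2 ^^ d) ((d1 ^^ c) f)"
proof -
  show *: "(d1 ^^ c) (d2 f) = d2 ((d1 ^^ c) f)" for c f
    by (induction c) (simp_all add: d_comm)
  show "d1 ((d2 ^^ d) f) = (d2 ^^ d) (d1 f)"
    by (induction d) (simp_all add: d_comm)
  show "(d1 ^^ c) ((d2 ^^ d) f) = (d2 ^^ d) ((d1 ^^ c) f)"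
    by (induction d) (simp_all add: *)
qed

lemma mon_comp_d:
  "mon a b c d (d1 f) = mon a b (Suc c) d f" "mon a b c d (d2 f) = mon a b c (Suc d) f"
  "mon a b c d ((d1 ^^ m) f) = mon a b (c + m) d f" "mon a b c d ((d2 ^^ m) f) = mon a b c (d + m) f"
  by (simp_all only: mon_def funpow_add funpow_Suc_right o_apply d_pow_comm)

lemma weyl_hom_funpow: "weyl_hom n P \<Longrightarrow> weyl_hom (int k * n) (P ^^ k)"
proof (induction k)
  case 0
  then show ?case using weyl_hom.scal[of 1] by (simp add: scal_1 End_ops id_def)
next
  case (Suc k)
  then show ?case using weyl_hom.mult[of n P "int k * n" "P ^^ k"]
    by (simp add: End_ops comp_def algebra_simps)
qed

lemma weyl_hom_mon: "weyl_hom (int a + int b - int c - int d) (mon a b c d)"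
proof -
  have "(x1 ^^ a) f = X1 ^ a * f" "(x2 ^^ a) f = X2 ^ a * f" for a f
    by (induction a) (simp_all add: x1_def x2_def)
  then have "mon a b c d = (x1 ^^ a) \<otimes>\<^bsub>End_B\<^esub> ((x2 ^^ b) \<otimes>\<^bsub>End_B\<^esub> ((d1 ^^ c) \<otimes>\<^bsub>End_B\<^esub> (d2 ^^ d)))"
    by (simp add: End_ops mon_def mult.assoc)
  moreover have "weyl_hom (int a * 1 + (int b * 1 + (int c * -1 + int d * -1))) \<dots>"
    by (intro weyl_hom.mult weyl_hom_funpow weyl_hom.x1 weyl_hom.x2 weyl_hom.d1 weyl_hom.d2)
  ultimately show ?thesis by (simp add: algebra_simps)
qed

lemma weyl_hom_sym_mon: "int a + int b - int c - int d = n \<Longrightarrow> weyl_hom n (sym_mon a b c d)"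
  using weyl_hom.add[of n "mon a b c d" "mon b a d c"] weyl_hom_mon[of a b c d] weyl_hom_mon[of b a d c]
  by (simp add: sym_mon_def End_ops algebra_simps)

lemma weyl_hom_End: "weyl_hom n P \<Longrightarrow> P \<in> carrier End_B"
  using weyl_hom_D_B subringE(1)[OF D_B_subring] by blast

lemmas mon_linear = End_linear[OF weyl_hom_End[OF weyl_hom_mon]]

inductive normal_span :: "int \<Rightarrow> (B \<Rightarrow> B) \<Rightarrow> bool" for n where
  mon: "int a + int b - int c - int d = n \<Longrightarrow> normal_span n (mon a b c d)"
| add: "normal_span n P \<Longrightarrow> normal_span n Q \<Longrightarrow> normal_span n (\<lambda>f. P f + Q f)"
| scale: "normal_span n P \<Longrightarrow> normal_span n (\<lambda>f. cst k * P f)"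

lemma x_mon: "x1 (mon a b c d f) = mon (Suc a) b c d f" "x2 (mon a b c d f) = mon a (Suc b) c d f"
  by (simp_all add: mon_def x1_def x2_def algebra_simps)

lemma d_mon:
  "d1 (mon a b c d f) = of_nat a * mon (a - 1) b c d f + mon a b (Suc c) d f"
  "d2 (mon a b c d f) = of_nat b * mon a (b - 1) c d f + mon a b c (Suc d) f"
  by (simp_all only: mon_def mult.assoc d_X_power funpow.simps o_apply d_pow_comm)
     (simp_all add: algebra_simps d_X_power)

text \<open>
  Pushing one generator at a time past a normally ordered monomial: a variable only raises an
  exponent, and a derivative leaves one lower monomial of the same total degree behind.
\<close>

lemma normal_span_comp:
  assumes "weyl_hom m P" "normal_span n Q" shows "normal_span (m + n) (\<lambda>f. P (Q f))"
  using assms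
proof (induction arbitrary: n Q rule: weyl_hom.induct)
  case (scal c)
  then show ?case using normal_span.scale by (simp add: scal_def)
next
  case x1
  then show ?case
  proof (induction rule: normal_span.induct)
    case (mon a b c d)
    then show ?case by (auto simp: x_mon intro!: normal_span.mon)
  qed (auto simp: x1_def algebra_simps intro: normal_span.intros dest: normal_span.scale)
next
  case x2
  then show ?case
  proof (induction rule: normal_span.induct)
    case (mon a b c d)
    then show ?case by (auto simp: x_mon intro!: normal_span.mon)
  qed (auto simp: x2_def algebra_simps intro: normal_span.intros dest: normal_span.scale)
next
  case d1
  then show ?case
  proof (induction rule: normal_span.induct)
    case (mon a b c d)
    have "normal_span (-1 + n) (\<lambda>f. cst (of_nat a) * mon (a - 1) b c d f)"
    proof (cases a)
      case 0
      \<comment> \<open>\<open>mon (a - 1) b c d\<close> has the wrong degree here; its coefficient is \<open>0\<close>, so a monomial of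
        the right degree can stand in for it.\<close>
      have "normal_span (-1 + n) (\<lambda>f. cst 0 * mon 0 b (Suc c) d f)"
        using mon 0 by (intro normal_span.intros) simp
      with 0 show ?thesis by simp
    qed (use mon in \<open>intro normal_span.intros, simp\<close>)
    then show ?case unfolding d_mon cst_of_nat[symmetric]
      by (rule normal_span.add) (use mon in \<open>intro normal_span.intros, simp\<close>)
  qed (auto simp: d1_der d_cst intro: normal_span.intros)
next
  case d2
  then show ?case
  proof (induction rule: normal_span.induct)
    case (mon a b c d)
    have "normal_span (-1 + n) (\<lambda>f. cst (of_nat b) * mon a (b - 1) c d f)"
    proof (cases b)
      case 0
      have "normal_span (-1 + n) (\<lambda>f. cst 0 * mon a 0 c (Suc d) f)"
        using mon 0 by (intro normal_span.intros) simp
      with 0 show ?thesis by simp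
    qed (use mon in \<open>intro normal_span.intros, simp\<close>)
    then show ?case unfolding d_mon cst_of_nat[symmetric]
      by (rule normal_span.add) (use mon in \<open>intro normal_span.intros, simp\<close>)
  qed (auto simp: d2_der d_cst intro: normal_span.intros)
next
  case (add n P Q)
  then show ?case by (auto simp: End_ops intro!: normal_span.add)
next
  case (mult m P n' Q')
  then show ?case using mult.IH(1)[OF mult.IH(2)[OF mult.prems]] by (simp add: End_ops add.assoc)
qed

lemma weyl_hom_normal_span: "weyl_hom n P \<Longrightarrow> normal_span n P"
  using normal_span_comp[of n P 0 "mon 0 0 0 0"] normal_span.mon[of 0 0 0 0 0]
  by (simp add: mon_def)

section \<open>The dihedral action on monomials\<close>

text \<open>
  \<open>\<epsilon>\<close> is a primitive \<open>e\<close>-th root of unity.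
\<close>

lemma eps_power_eq_iff:
  assumes "e \<ge> 1" shows "eps e ^ m = eps e ^ n \<longleftrightarrow> [m = n] (mod e)"
proof -
  have "eps e ^ k = cis (2 * pi * real (k mod e) / real e)" for k
  proof -
    have "eps e ^ k = eps e ^ (e * (k div e) + k mod e)" by simp
    also have "\<dots> = eps e ^ (k mod e)"
      by (simp only: power_add power_mult eps_power[OF assms]) simp
    also have "\<dots> = cis (2 * pi / real e) ^ (k mod e)"
      by (simp add: eps_def cis_conv_exp mult_ac)
    also have "\<dots> = cis (2 * pi * real (k mod e) / real e)"
      unfolding DeMoivre by (simp add: mult_ac)
    finally show ?thesis .
  qed
  moreover have "inj_on (\<lambda>k. cis (2 * pi * real k / real e)) {..<e}"
    using bij_betw_roots_unity[of e] assms by (simp add: bij_betw_def)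
  from inj_on_eq_iff[OF this, of "m mod e" "n mod e"]
  have "cis (2 * pi * real (m mod e) / real e) = cis (2 * pi * real (n mod e) / real e)
      \<longleftrightarrow> m mod e = n mod e"
    using assms by simp
  ultimately show ?thesis by (simp add: cong_def)
qed

text \<open>
  The eigenvalue of a monomial under conjugation by \<open>\<rho>\<close>: \<open>x\<^sub>1\<close> and \<open>\<partial>\<^sub>2\<close> have eigenvalue
  \<open>\<epsilon>\<close>, while \<open>x\<^sub>2\<close> and \<open>\<partial>\<^sub>1\<close> have \<open>\<epsilon>\<^bsup>-1\<^esup>\<close>.
\<close>

abbreviation rho_weight :: "nat \<Rightarrow> nat \<Rightarrow> nat \<Rightarrow> nat \<Rightarrow> nat \<Rightarrow> complex" where
  "rho_weight e a b c d \<equiv> eps e ^ (a + d) / eps e ^ (b + c)"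

lemma rho_weight_eq_1_iff:
  "e \<ge> 1 \<Longrightarrow> rho_weight e a b c d = 1 \<longleftrightarrow> [a + d = b + c] (mod e)"
  by (simp add: eps_nz eps_power_eq_iff)

lemma funpow_d_cst: "(d1 ^^ c) (cst k * f) = cst k * (d1 ^^ c) f" "(d2 ^^ c) (cst k * f) = cst k * (d2 ^^ c) f"
  by (induction c) (simp_all add: d_cst)

lemma rho_power: "rho e (p ^ n) = rho e p ^ n"
  by (induction n) (simp_all add: rho_gens)

lemma sigma_power: "sigma (p ^ n) = sigma p ^ n"
  by (induction n) (simp_all add: sigma_gens)

lemma rho_mon: "rho e (mon a b c d f) = cst (rho_weight e a b c d) * mon a b c d (rho e f)"
proof -
  have 1: "rho e (d1 f) = cst (inverse (eps e)) * d1 (rho e f)"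
    "rho e (d2 f) = cst (eps e) * d2 (rho e f)" for f
    by (simp_all add: d_rho cst_inv eps_nz)
  have 2: "rho e ((d1 ^^ c) f) = cst (inverse (eps e) ^ c) * (d1 ^^ c) (rho e f)" for c f
    by (induction c) (simp_all add: 1 d_cst algebra_simps)
  have 3: "rho e ((d2 ^^ c) f) = cst (eps e ^ c) * (d2 ^^ c) (rho e f)" for c f
    by (induction c) (simp_all add: 1 d_cst algebra_simps)
  show ?thesis
    by (simp add: mon_def rho_gens rho_power 2 3 power_mult_distrib funpow_d_cst power_add
        divide_inverse flip: power_inverse cst_power; simp add: algebra_simps)
qed

lemma sigma_mon: "sigma (mon a b c d f) = mon b a d c (sigma f)"
proof -
  have "sigma ((d1 ^^ c) f) = (d2 ^^ c) (sigma f)" "sigma ((d2 ^^ c) f) = (d1 ^^ c) (sigma f)" for c f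
    by (induction c) (simp_all flip: d_sigma)
  then show ?thesis
    by (simp add: mon_def sigma_gens sigma_power d_pow_comm mult.commute)
qed

lemma sym_mon_D_2:
  assumes "e \<ge> 1" "[a + d = b + c] (mod e)"
  shows "sym_mon a b c d \<in> carrier (D_2 e)"
proof -
  have "rho_weight e a b c d = 1" "rho_weight e b a d c = 1"
    using assms rho_weight_eq_1_iff cong_sym by blast+
  then have "rho e (sym_mon a b c d f) = sym_mon a b c d (rho e f)" for f
    by (simp add: sym_mon_def rho_gens rho_mon del: power_add)
  moreover have "sigma (sym_mon a b c d f) = sym_mon a b c d (sigma f)" for f
    by (simp add: sym_mon_def sigma_gens sigma_mon)
  moreover have "sym_mon a b c d \<in> carrier D_B"
    using weyl_hom_sym_mon weyl_hom_D_B by blast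
  ultimately show ?thesis using commute_dihedral unfolding carrier_D_2 by blast
qed

section \<open>Operators in the left ideal\<close>

lemma left_idealI:
  assumes "P \<in> carrier (D_2 e)" "Q \<in> D_2_part e n" "n < 0"
  shows "(\<lambda>f. P (Q f)) \<in> left_ideal e"
proof -
  have "Q \<in> D_2_neg e"
    unfolding D_2_neg_def using assms by (intro generate.incl) auto
  from ideal_prod.prod[OF assms(1) this, of "D_2 e"] show ?thesis
    by (simp add: left_ideal_def End_ops)
qed

lemma D_2_0_iff: "P \<in> carrier (D_2_0 e) \<longleftrightarrow> P \<in> carrier (D_2 e) \<and> weyl_hom 0 P"
  by (simp add: carrier_D_2_0)

lemma D_2_0_End: "P \<in> carrier (D_2_0 e) \<Longrightarrow> P \<in> carrier End_B"
  using subringE(1)[OF D_2_0_subring] by blast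

lemma sym_mon_D_2_0:
  assumes "e \<ge> 1" "[a + d = b + c] (mod e)" "a + b = c + d"
  shows "sym_mon a b c d \<in> carrier (D_2_0 e)"
  using sym_mon_D_2[OF assms(1,2)] assms(3) by (simp add: D_2_0_iff weyl_hom_sym_mon)

lemma d1d2_part: "(\<lambda>f. d1 (d2 f)) \<in> D_2_part e (-2)"
proof -
  have h: "weyl_hom (-2) (\<lambda>f. d1 (d2 f))"
    using weyl_hom.mult[OF weyl_hom.d1 weyl_hom.d2] by (simp add: End_ops)
  have "rho e (d1 (d2 f)) = d1 (d2 (rho e f))" for f
    by (simp add: d_rho d_cst cst_inv eps_nz)
  moreover have "sigma (d1 (d2 f)) = d1 (d2 (sigma f))" for f
    by (simp add: d_sigma d_comm)
  ultimately have "g (d1 (d2 f)) = d1 (d2 (g f))" if "g \<in> dihedral e" for g f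
    by (intro commute_dihedral[OF that, where P = "\<lambda>f. d1 (d2 f)"])
  then show ?thesis
    using h weyl_hom_D_B[OF h] by (simp add: D_2_part_def carrier_D_2)
qed

text \<open>
  The operator \<open>\<partial>\<^sub>1\<partial>\<^sub>2\<close> is invariant of degree \<open>-2\<close> and can be split off on the right, and the
  cofactor stays invariant because \<open>\<partial>\<^sub>1\<partial>\<^sub>2\<close> has weight \<open>1\<close>.
\<close>

lemma sym_mon_mixed_in_I_2:
  assumes "e \<ge> 1" "[a + d = b + c] (mod e)" "a + b = c + d" "c \<ge> 1" "d \<ge> 1"
  shows "sym_mon a b c d \<in> I_2 e"
proof -
  obtain c' d' where cd: "c = Suc c'" "d = Suc d'" using assms by (metis Suc_le_D One_nat_def)
  have "sym_mon a b c d = (\<lambda>f. sym_mon a b c' d' (d1 (d2 f)))"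
    by (simp add: sym_mon_def cd mon_comp_d)
  moreover have "[a + d' = b + c'] (mod e)"
    using assms(2) cong_add_rcancel_nat[of "a + d'" 1 "b + c'"] by (simp add: cd)
  then have "sym_mon a b c' d' \<in> carrier (D_2 e)" by (rule sym_mon_D_2[OF assms(1)])
  ultimately have "sym_mon a b c d \<in> left_ideal e"
    using left_idealI[OF _ d1d2_part] by simp
  then show ?thesis using sym_mon_D_2_0[OF assms(1-3)] by (simp add: I_2_def)
qed

lemma powers_part:
  assumes "e \<ge> 1" shows "(\<lambda>f. (d1 ^^ e) f + (d2 ^^ e) f) \<in> D_2_part e (- int e)"
proof -
  have "(\<lambda>f. (d1 ^^ e) f + (d2 ^^ e) f) = sym_mon 0 0 e 0"
    by (simp add: sym_mon_def mon_def)
  then show ?thesis using sym_mon_D_2[OF assms, of 0 0 0 e] weyl_hom_sym_mon[of 0 0 e 0]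
    by (simp add: D_2_part_def cong_def)
qed

section \<open>Averaging over the dihedral group\<close>

text \<open>
  Summing over the group without dividing by its order. The inverse of \<open>\<rho>\<^sup>i\<close> is written as
  \<open>\<rho>\<^bsup>e-i\<^esup>\<close>, so that only powers of \<open>\<rho>\<close> occur.
\<close>

definition rho_average :: "nat \<Rightarrow> (B \<Rightarrow> B) \<Rightarrow> B \<Rightarrow> B" where
  "rho_average e P = (\<lambda>f. \<Sum>i<e. (rho e ^^ i) (P ((rho e ^^ (e - i)) f)))"

definition dihedral_average :: "nat \<Rightarrow> (B \<Rightarrow> B) \<Rightarrow> B \<Rightarrow> B" where
  "dihedral_average e P = (\<lambda>f. rho_average e P f + sigma (rho_average e P (sigma f)))"

lemma rho_funpow:
  "(rho e ^^ i) (f + g) = (rho e ^^ i) f + (rho e ^^ i) g"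
  "(rho e ^^ i) (cst k * f) = cst k * (rho e ^^ i) f"
  by (induction i) (simp_all add: rho_gens)

lemma rho_order:
  assumes "e \<ge> 1" shows "rho e ^^ e = id"
proof (rule alg_endo_ext)
  have "alg_endo (rho e ^^ i)" for i
    by (induction i) (simp_all only: funpow.simps alg_endo_id alg_endo_comp alg_endo_subst rho_def)
  then show "alg_endo (rho e ^^ e)" .
  have *: "(rho e ^^ i) X1 = cst (eps e ^ i) * X1"
    "(rho e ^^ i) X2 = cst (inverse (eps e) ^ i) * X2" for i
    by (induction i) (simp_all add: rho_gens algebra_simps)
  show "(rho e ^^ e) X1 = id X1" "(rho e ^^ e) X2 = id X2"
    by (simp_all add: * power_inverse eps_power[OF assms])
qed (rule alg_endo_id)

lemma rho_order_split:
  assumes "e \<ge> 1" "i < e" shows "(rho e ^^ i) ((rho e ^^ (e - i)) f) = f"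
proof -
  have "(rho e ^^ i) ((rho e ^^ (e - i)) f) = (rho e ^^ (i + (e - i))) f"
    by (simp add: funpow_add)
  then show ?thesis using assms by (simp add: rho_order)
qed

lemma dihedral_average_linear:
  "dihedral_average e (\<lambda>f. P f + Q f) = (\<lambda>f. dihedral_average e P f + dihedral_average e Q f)"
  "dihedral_average e (\<lambda>f. cst k * P f) = (\<lambda>f. cst k * dihedral_average e P f)"
proof -
  have "rho_average e (\<lambda>f. P f + Q f) f = rho_average e P f + rho_average e Q f" for f
    by (simp add: rho_average_def rho_funpow sum.distrib)
  then show "dihedral_average e (\<lambda>f. P f + Q f) = (\<lambda>f. dihedral_average e P f + dihedral_average e Q f)"
    by (simp add: dihedral_average_def sigma_gens algebra_simps)
  have "rho_average e (\<lambda>f. cst k * P f) f = cst k * rho_average e P f" for f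
    by (simp add: rho_average_def rho_funpow sum_distrib_left)
  then show "dihedral_average e (\<lambda>f. cst k * P f) = (\<lambda>f. cst k * dihedral_average e P f)"
    by (simp add: dihedral_average_def sigma_gens algebra_simps)
qed

lemma sigma_sigma: "sigma (sigma f) = f"
proof -
  have "sigma \<circ> sigma = id"
    unfolding sigma_def by (rule subst_id) (simp_all add: subst_gens)
  then show ?thesis by (simp add: fun_eq_iff)
qed

lemma dihedral_average_invariant:
  assumes "e \<ge> 1" "P \<in> carrier (D_2 e)"
  shows "dihedral_average e P f = cst (of_nat (2 * e)) * P f"
proof -
  have mem: "rho e \<in> dihedral e" "sigma \<in> dihedral e"
    by (simp_all add: dihedral_def generate.incl)
  then have c: "rho e (P f) = P (rho e f)" "sigma (P f) = P (sigma f)" for f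
    using assms(2) by (simp_all add: carrier_D_2)
  then have "(rho e ^^ i) (P f) = P ((rho e ^^ i) f)" for i f
    by (induction i) simp_all
  then have "rho_average e P f = of_nat e * P f" for f
    by (simp add: rho_average_def rho_order_split[OF assms(1)])
  moreover have "sigma (of_nat n * f) = of_nat n * sigma f" for n f
    by (simp add: sigma_gens flip: cst_of_nat)
  moreover have "sigma (sigma f) = f" by (rule sigma_sigma)
  ultimately show ?thesis
    unfolding cst_of_nat by (simp add: dihedral_average_def c)
qed

text \<open>
  A monomial is an eigenvector for conjugation by \<open>\<rho>\<close>, so its sum over \<open>\<langle>\<rho>\<rangle>\<close> is a geometric
  sum in an \<open>e\<close>-th root of unity, which vanishes unless the eigenvalue is \<open>1\<close>.
\<close>

lemma dihedral_average_mon: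
  assumes "e \<ge> 1"
  shows "dihedral_average e (mon a b c d)
    = (\<lambda>f. cst (if [a + d = b + c] (mod e) then of_nat e else 0) * sym_mon a b c d f)"
proof -
  let ?t = "rho_weight e a b c d"
  have "(rho e ^^ i) (mon a b c d f) = cst (?t ^ i) * mon a b c d ((rho e ^^ i) f)" for i f
    by (induction i) (simp, simp only: funpow.simps o_apply rho_gens rho_mon power_Suc cst_simps mult_ac)
  then have "rho_average e (mon a b c d) f = (\<Sum>i<e. cst (?t ^ i) * mon a b c d f)" for f
    by (simp only: rho_average_def) (simp add: rho_order_split[OF assms])
  then have "rho_average e (mon a b c d) f = cst (\<Sum>i<e. ?t ^ i) * mon a b c d f" for f
    by (simp only: cst_sum sum_distrib_right)
  moreover have "(\<Sum>i<e. ?t ^ i) = (if [a + d = b + c] (mod e) then of_nat e else 0)"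
  proof (cases "[a + d = b + c] (mod e)")
    case True
    then have "?t = 1" using rho_weight_eq_1_iff[OF assms] by blast
    with True show ?thesis by (simp only: power_one if_True) simp
  next
    case False
    then have "?t \<noteq> 1" using rho_weight_eq_1_iff[OF assms] by blast
    moreover have "(eps e ^ m) ^ e = 1" for m
      using eps_power[OF assms] by (metis power_mult mult.commute power_one)
    then have "?t ^ e = 1" by (simp only: power_divide) simp
    ultimately show ?thesis using False geometric_sum[of ?t e] by simp
  qed
  ultimately have "rho_average e (mon a b c d) f
      = cst (if [a + d = b + c] (mod e) then of_nat e else 0) * mon a b c d f" for f
    by (simp only:)
  moreover have "sigma (sigma f) = f" for f
    by (rule sigma_sigma)
  ultimately show ?thesis
    by (simp only: dihedral_average_def sym_mon_def sigma_gens sigma_mon distrib_left)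
qed

text \<open>
  Invariants of a given degree are spanned by symmetrised monomials of trivial weight: an
  invariant is a multiple of its own group sum, and the group sum of a monomial is such an
  element or zero.
\<close>

lemma D_2_part_induct:
  assumes e: "e \<ge> 1" and P: "P \<in> D_2_part e n"
    and zero: "S (\<lambda>f. 0)"
    and sym: "\<And>a b c d. \<lbrakk>int a + int b - int c - int d = n; [a + d = b + c] (mod e)\<rbrakk> \<Longrightarrow> S (sym_mon a b c d)"
    and add: "\<And>P Q. S P \<Longrightarrow> S Q \<Longrightarrow> S (\<lambda>f. P f + Q f)"
    and scale: "\<And>k P. S P \<Longrightarrow> S (\<lambda>f. cst k * P f)"
  shows "S P"
proof -
  have "S (dihedral_average e Q)" if "normal_span n Q" for Q
    using that
  proof (induction rule: normal_span.induct)
    case (mon a b c d)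
    then show ?case
      using scale[OF sym[of a b c d], of "of_nat e"] zero by (auto simp: dihedral_average_mon[OF e])
  qed (simp_all add: dihedral_average_linear add scale)
  then have "S (dihedral_average e P)"
    using P weyl_hom_normal_span by (simp add: D_2_part_def)
  then have "S (\<lambda>f. cst (inverse (of_nat (2 * e))) * dihedral_average e P f)" by (rule scale)
  moreover have "cst (inverse (of_nat (2 * e))) * dihedral_average e P f = P f" for f
    using P e by (simp only: D_2_part_def dihedral_average_invariant mem_Collect_eq) (rule cst_inv, simp)
  ultimately show ?thesis by simp
qed

section \<open>The Euler operator\<close>

lemma nabla_apply: "nabla f = x1 (d1 f) + x2 (d2 f)"
  by (simp add: nabla_def End_ops)

lemma nabla_mon:
  "nabla (mon a b c d f) = of_nat (a + b) * mon a b c d f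
     + mon (Suc a) b (Suc c) d f + mon a (Suc b) c (Suc d) f"
proof -
  have "x1 (of_nat n * f) = of_nat n * x1 f" "x1 (f + g) = x1 f + x1 g"
    "x2 (of_nat n * f) = of_nat n * x2 f" "x2 (f + g) = x2 f + x2 g" for n f g
    by (simp_all add: x1_def x2_def algebra_simps)
  then have "nabla (mon a b c d f) = of_nat a * mon (Suc (a - 1)) b c d f
      + of_nat b * mon a (Suc (b - 1)) c d f + mon (Suc a) b (Suc c) d f + mon a (Suc b) c (Suc d) f"
    by (simp add: nabla_apply d_mon x_mon)
  then show ?thesis by (cases a; cases b) (simp_all add: algebra_simps)
qed

text \<open>
  The identity behind the reduction: for \<open>c > 0\<close> and \<open>d = 0\<close> the last summand is killed in
  \<open>R\<^sub>2\<close>, so multiplication by \<open>\<nabla> - (a + b)\<close> raises the exponents of \<open>x\<^sub>1\<close> and \<open>\<partial>\<^sub>1\<close> together.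
\<close>

lemma nabla_sym_mon:
  "nabla (sym_mon a b c d f) = of_nat (a + b) * sym_mon a b c d f
     + sym_mon (Suc a) b (Suc c) d f + sym_mon a (Suc b) c (Suc d) f"
proof -
  have "nabla (f + g) = nabla f + nabla g" for f g
    by (simp add: nabla_apply d1_der d2_der x1_def x2_def algebra_simps)
  then show ?thesis by (simp add: sym_mon_def nabla_mon algebra_simps)
qed

text \<open>
  \<open>\<nabla>\<close> is the Euler operator, so bracketing with it multiplies by the degree; in particular it
  is central among the operators of degree 0.
\<close>

lemma nabla_commutator:
  assumes "weyl_hom n P"
  shows "nabla (P f) = P (nabla f) + of_int n * P f"
  using assms
proof (induction arbitrary: f rule: weyl_hom.induct)
  case (mult m P n Q)
  have "P (Q (nabla f) + of_int n * Q f) = P (Q (nabla f)) + of_int n * P (Q f)"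
    using End_linear[OF weyl_hom_End[OF mult.hyps(1)]] by (simp flip: cst_of_int)
  then show ?case by (simp add: End_ops mult.IH algebra_simps)
qed (simp_all add: nabla_apply scal_def x1_def x2_def d_cst d1_der d2_der End_ops d_comm algebra_simps
  weyl_hom_End[THEN End_linear(1)])

lemma C_nabla_subring: "subring (carrier C_nabla) End_B"
proof -
  have "nabla \<in> carrier End_B"
    using nabla_D_2_0 subringE(1)[OF D_2_0_subring] by blast
  then have "range scal \<union> {nabla} \<subseteq> carrier End_B" using gens_End by auto
  then show ?thesis
    using End.generate_ring_is_subring by (simp add: C_nabla_def alg_gen_def)
qed

lemma C_nabla_gens: "nabla \<in> carrier C_nabla" "scal c \<in> carrier C_nabla"
  by (auto simp: C_nabla_def alg_gen_def intro: generate_ring.incl)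

lemma C_nabla_induct [consumes 1, case_names scal nabla add mult]:
  assumes "F \<in> carrier C_nabla"
    and scal: "\<And>c. S (scal c)" and "S nabla"
    and add: "\<And>F G. \<lbrakk>F \<in> carrier C_nabla; G \<in> carrier C_nabla; S F; S G\<rbrakk> \<Longrightarrow> S (\<lambda>f. F f + G f)"
    and mult: "\<And>F G. \<lbrakk>F \<in> carrier C_nabla; G \<in> carrier C_nabla; S F; S G\<rbrakk> \<Longrightarrow> S (\<lambda>f. F (G f))"
  shows "S F"
proof -
  have c: "carrier C_nabla = generate_ring End_B (range scal \<union> {nabla})"
    by (simp add: C_nabla_def alg_gen_def)
  have "F \<in> generate_ring End_B (range scal \<union> {nabla})" using assms(1) by (simp add: c)
  then show ?thesis
  proof (induction rule: generate_ring.induct)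
    case one
    then show ?case using scal[of 1] by (simp add: scal_1)
  next
    case (incl h)
    then show ?case using assms by auto
  next
    case (a_inv h)
    have "h \<in> carrier End_B" using a_inv subringE(1)[OF C_nabla_subring] by (auto simp: c)
    then show ?case
      using mult[OF C_nabla_gens(2) _ scal, of h "-1"] a_inv by (simp add: c uminus_End End_ops)
  qed (use add mult in \<open>simp_all add: c End_ops\<close>)
qed

lemma C_nabla_commutes:
  assumes "F \<in> carrier C_nabla" "P \<in> carrier (D_2_0 e)"
  shows "F (P f) = P (F f)"
  using assms(1)
proof (induction arbitrary: f rule: C_nabla_induct)
  case (scal c)
  have "P \<in> carrier End_B" using assms(2) by (rule D_2_0_End)
  then show ?case by (simp add: scal_def End_linear)
next
  case nabla
  then show ?case using assms(2) nabla_commutator[of 0 P] by (simp add: D_2_0_iff)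
next
  case (add F G)
  have "P \<in> carrier End_B" using assms(2) by (rule D_2_0_End)
  with add show ?case by (simp add: End_linear)
qed simp_all

lemma C_nabla_closed:
  assumes "F \<in> carrier C_nabla" "G \<in> carrier C_nabla"
  shows "(\<lambda>f. F f + G f) \<in> carrier C_nabla" "(\<lambda>f. F (G f)) \<in> carrier C_nabla"
  using subringE(6,7)[OF C_nabla_subring assms] by (simp_all add: End_ops)

lemma C_nabla_zero: "(\<lambda>f. 0) \<in> carrier C_nabla"
  using subringE(2)[OF C_nabla_subring] by (simp add: End_ops)

lemma I_2_closed:
  assumes "P \<in> I_2 e"
  shows "Q \<in> I_2 e \<Longrightarrow> (\<lambda>f. P f + Q f) \<in> I_2 e"
    "Q \<in> carrier (D_2_0 e) \<Longrightarrow> (\<lambda>f. Q (P f)) \<in> I_2 e"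
  using additive_subgroup.a_closed[OF ideal.axioms(1)[OF I_2_ideal] assms]
    ideal.I_l_closed[OF I_2_ideal assms] by (simp_all add: End_ops)

lemma I_2_zero: "(\<lambda>f. 0) \<in> I_2 e"
  using additive_subgroup.zero_closed[OF ideal.axioms(1)[OF I_2_ideal]] by (simp add: End_ops)

section \<open>Reduction modulo lowering operators\<close>

text \<open>
  The invariants of degree 0 whose class lies in \<open>E + E\<cdot>[W]\<close>, where \<open>E\<close> is the image of
  \<open>\<complex>[\<nabla>]\<close>. The free parameter \<open>W\<close> treats both parities at once: it is \<open>w_2 k\<close> for \<open>e = 2 * k\<close>
  and zero for odd \<open>e\<close>.
\<close>

definition nabla_span :: "nat \<Rightarrow> (B \<Rightarrow> B) \<Rightarrow> (B \<Rightarrow> B) set" where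
  "nabla_span e W = {P. \<exists>F \<in> carrier C_nabla. \<exists>G \<in> carrier C_nabla. \<exists>I \<in> I_2 e.
     P = (\<lambda>f. F f + G (W f) + I f)}"

lemma C_nabla_End: "F \<in> carrier C_nabla \<Longrightarrow> F \<in> carrier End_B"
  using subringE(1)[OF C_nabla_subring] by blast

lemma nabla_span_add:
  assumes "P \<in> nabla_span e W" "Q \<in> nabla_span e W"
  shows "(\<lambda>f. P f + Q f) \<in> nabla_span e W"
proof -
  from assms obtain F G I F' G' I' where *: "F \<in> carrier C_nabla" "G \<in> carrier C_nabla"
    "F' \<in> carrier C_nabla" "G' \<in> carrier C_nabla" "I \<in> I_2 e" "I' \<in> I_2 e"
    "P = (\<lambda>f. F f + G (W f) + I f)" "Q = (\<lambda>f. F' f + G' (W f) + I' f)"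
    unfolding nabla_span_def by blast
  show ?thesis unfolding nabla_span_def mem_Collect_eq
    by (rule bexI[OF _ C_nabla_closed(1)[OF *(1,3)]], rule bexI[OF _ C_nabla_closed(1)[OF *(2,4)]],
        rule bexI[OF _ I_2_closed(1)[OF *(5,6)]]) (simp add: * algebra_simps)
qed

lemma nabla_span_C_nabla:
  assumes "H \<in> carrier C_nabla" "P \<in> nabla_span e W"
  shows "(\<lambda>f. H (P f)) \<in> nabla_span e W"
proof -
  from assms(2) obtain F G I where *: "F \<in> carrier C_nabla" "G \<in> carrier C_nabla" "I \<in> I_2 e"
    "P = (\<lambda>f. F f + G (W f) + I f)"
    unfolding nabla_span_def by blast
  show ?thesis unfolding nabla_span_def mem_Collect_eq
    by (rule bexI[OF _ C_nabla_closed(2)[OF assms(1) *(1)]],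
        rule bexI[OF _ C_nabla_closed(2)[OF assms(1) *(2)]],
        rule bexI[OF _ I_2_closed(2)[OF *(3) subsetD[OF C_nabla_sub assms(1)]]])
      (simp add: * End_linear[OF C_nabla_End[OF assms(1)]])
qed

lemma nabla_span_scale: "P \<in> nabla_span e W \<Longrightarrow> (\<lambda>f. cst k * P f) \<in> nabla_span e W"
  using nabla_span_C_nabla[OF C_nabla_gens(2)[of k]] by (simp add: scal_def)

lemma nabla_span_diff:
  assumes "P \<in> nabla_span e W" "Q \<in> nabla_span e W"
  shows "(\<lambda>f. P f - Q f) \<in> nabla_span e W"
  using nabla_span_add[OF assms(1) nabla_span_scale[OF assms(2), of "-1"]] by (simp add: cst_uminus)

lemma nabla_span_base:
  "I \<in> I_2 e \<Longrightarrow> I \<in> nabla_span e W" "F \<in> carrier C_nabla \<Longrightarrow> F \<in> nabla_span e W" "W \<in> nabla_span e W"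
proof -
  have *: "(\<lambda>f. F f + G (W f) + I f) \<in> nabla_span e W"
    if "F \<in> carrier C_nabla" "G \<in> carrier C_nabla" "I \<in> I_2 e" for F G I
    using that unfolding nabla_span_def by blast
  note z = C_nabla_zero I_2_zero
  show "I \<in> I_2 e \<Longrightarrow> I \<in> nabla_span e W" using *[OF z(1) z(1)] by simp
  show "F \<in> carrier C_nabla \<Longrightarrow> F \<in> nabla_span e W" using *[OF _ z] by simp
  show "W \<in> nabla_span e W" using *[OF z(1) C_nabla_gens(2)[of 1] z(2)] by (simp add: scal_def)
qed

lemma sym_mon_raise:
  assumes e: "e \<ge> 1" and c: "c \<ge> 1" "a + b = c" "[a = b + c] (mod e)"
    and P: "sym_mon a b c 0 \<in> nabla_span e W"
  shows "sym_mon (Suc a) b (Suc c) 0 \<in> nabla_span e W"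
proof -
  have "[a + 1 = Suc b + c] (mod e)"
    using cong_add[OF c(3) cong_refl[of 1]] by simp
  then have "sym_mon a (Suc b) c 1 \<in> I_2 e"
    by (rule sym_mon_mixed_in_I_2[OF e]) (use c in simp_all)
  then have "sym_mon a (Suc b) c 1 \<in> nabla_span e W" by (rule nabla_span_base(1))
  from nabla_span_diff[OF nabla_span_diff[OF nabla_span_C_nabla[OF C_nabla_gens(1) P]
      nabla_span_scale[OF P, of "of_nat (a + b)"]] this]
  show ?thesis unfolding nabla_sym_mon cst_of_nat by simp
qed

text \<open>
  Given \<open>a + b = c\<close> and \<open>d = 0\<close>, invariance under \<open>\<rho>\<close> amounts to \<open>e\<close> dividing \<open>2 * b\<close>; this
  does not involve \<open>a\<close>, so the raising step can be repeated.
\<close>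

lemma sym_mon_raise_iter:
  assumes e: "e \<ge> 1" and "[2 * b = 0] (mod e)" "n + b \<ge> 1"
    and P: "sym_mon n b (n + b) 0 \<in> nabla_span e W"
  shows "sym_mon (n + k) b (n + k + b) 0 \<in> nabla_span e W"
proof (induction k)
  case 0
  then show ?case using P by simp
next
  case (Suc k)
  have "[n + k + 0 = n + k + 2 * b] (mod e)"
    using assms(2) by (simp only: cong_add_lcancel_nat cong_sym_eq)
  then have "[n + k = b + (n + k + b)] (mod e)" by (simp add: mult_2 add_ac)
  have "sym_mon (Suc (n + k)) b (Suc (n + k + b)) 0 \<in> nabla_span e W"
    by (rule sym_mon_raise[OF e _ _ \<open>[n + k = b + (n + k + b)] (mod e)\<close> Suc]) (use assms(3) in auto)
  then show ?case by simp
qed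

text \<open>
  The chain that starts from the scalar \<open>2\<close>. It has to be entered at \<open>\<nabla>\<close> because the raising step
  needs \<open>c \<ge> 1\<close>.
\<close>

lemma sym_mon_pure: "sym_mon n 0 n 0 \<in> nabla_span e W" if "e \<ge> 1"
proof -
  have "sym_mon 0 0 0 0 = scal 2"
    using cst_of_nat[of 2] by (auto simp: sym_mon_def mon_def scal_def)
  then have 0: "sym_mon 0 0 0 0 \<in> nabla_span e W"
    using nabla_span_base(2)[OF C_nabla_gens(2)] by simp
  have "sym_mon 1 0 1 0 = nabla"
    by (auto simp: sym_mon_def mon_def nabla_apply x1_def x2_def)
  then have "sym_mon (1 + 0) 0 (1 + 0) 0 \<in> nabla_span e W"
    using nabla_span_base(2)[OF C_nabla_gens(1)] by simp
  then have "sym_mon (1 + k) 0 (1 + k) 0 \<in> nabla_span e W" for k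
    using sym_mon_raise_iter[OF that, of 0 1 W k] by simp
  with 0 show ?thesis by (cases n) simp_all
qed

text \<open>
  The powers of \<open>x\<^sub>1\<partial>\<^sub>2\<close> and of \<open>x\<^sub>2\<partial>\<^sub>1\<close> are already normally ordered, since \<open>x\<^sub>1\<close> commutes
  with \<open>\<partial>\<^sub>2\<close> and \<open>x\<^sub>2\<close> with \<open>\<partial>\<^sub>1\<close>.
\<close>

lemma w_2_eq: "w_2 k = sym_mon 0 k k 0"
proof -
  have d: "(d2 ^^ k) (X1 * f) = X1 * (d2 ^^ k) f" "(d1 ^^ k) (X2 * f) = X2 * (d1 ^^ k) f" for k f
    by (induction k) (simp_all add: d_X_power(2)[of 1, simplified] d_X_power(4)[of 1, simplified])
  have "((x1 \<otimes>\<^bsub>End_B\<^esub> d2) [^]\<^bsub>End_B\<^esub> k) f = X1 ^ k * (d2 ^^ k) f"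
    "((x2 \<otimes>\<^bsub>End_B\<^esub> d1) [^]\<^bsub>End_B\<^esub> k) f = X2 ^ k * (d1 ^^ k) f" for f
    by (induction k arbitrary: f)
      (simp_all add: End_ops x1_def x2_def d funpow_swap1 algebra_simps)
  then show ?thesis
    by (simp add: w_2_def sym_mon_def mon_def End_ops add.commute)
qed

text \<open>
  Here \<open>c \<ge> b \<ge> e\<close>, so the invariant \<open>\<partial>\<^sub>1^e + \<partial>\<^sub>2^e\<close> of degree \<open>-e\<close> can be split off on the
  right, at the price of the cross terms \<open>sym_mon a b (c - e) e\<close>. Those contain \<open>\<partial>\<^sub>1\<partial>\<^sub>2\<close>, except
  when \<open>c = e\<close>; then they are \<open>x\<^sub>1^e\<partial>\<^sub>1^e + x\<^sub>2^e\<partial>\<^sub>2^e\<close>, a polynomial in \<open>\<nabla>\<close> modulo the ideal.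
\<close>

lemma sym_mon_second_exponent_ge:
  assumes e: "e \<ge> 1" and b: "[2 * b = 0] (mod e)" "b \<ge> e" "a + b = c"
  shows "sym_mon a b c 0 \<in> nabla_span e W"
proof -
  obtain c' where c': "c = c' + e" using b by (metis le_add_diff_inverse2 trans_le_add2)
  have "[a + 0 = a + 2 * b] (mod e)"
    using b(1) by (simp only: cong_add_lcancel_nat cong_sym_eq)
  moreover have "a + 2 * b = b + c' + e" using b c' by simp
  ultimately have "a mod e = (b + c') mod e" by (simp add: cong_def)
  then have inv: "[a + 0 = b + c'] (mod e)" "[a + 0 = b + c] (mod e)" "[a + e = b + c'] (mod e)"
    by (simp_all add: cong_def c' flip: add.assoc)
  let ?Q = "\<lambda>f. sym_mon a b c' 0 ((d1 ^^ e) f + (d2 ^^ e) f)"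
  have Q: "?Q = (\<lambda>f. sym_mon a b c 0 f + sym_mon a b c' e f)"
    by (simp add: sym_mon_def mon_linear mon_comp_d c' algebra_simps)
  have m: "sym_mon a b c 0 \<in> carrier (D_2_0 e)" "sym_mon a b c' e \<in> carrier (D_2_0 e)"
    using b(3) c' inv by (auto intro!: sym_mon_D_2_0[OF e])
  have "?Q \<in> left_ideal e"
    using left_idealI[OF sym_mon_D_2[OF e inv(1)] powers_part[OF e]] e by simp
  moreover have "?Q \<in> carrier (D_2_0 e)"
    using subringE(7)[OF D_2_0_subring m] by (simp add: Q End_ops)
  ultimately have "?Q \<in> nabla_span e W" by (intro nabla_span_base) (simp add: I_2_def)
  moreover have "sym_mon a b c' e \<in> nabla_span e W"
  proof (cases "c' = 0")
    case True
    then have "a = 0" "b = e" using b c' by auto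
    then show ?thesis using sym_mon_pure[OF e, of e W] True sym_mon_swap[of e 0 e 0] by simp
  next
    case False
    then show ?thesis
      using sym_mon_mixed_in_I_2[OF e inv(3)] b c' e by (intro nabla_span_base) simp
  qed
  ultimately have "(\<lambda>f. ?Q f - sym_mon a b c' e f) \<in> nabla_span e W"
    by (rule nabla_span_diff)
  then show ?thesis by (simp add: fun_cong[OF Q])
qed

text \<open>
  Mixed monomials vanish in the quotient, and exchanging the two indices reduces the rest to
  \<open>d = 0\<close>. Invariance then says that \<open>e\<close> divides \<open>2 * b\<close>, which leaves \<open>b = 0\<close>, \<open>b \<ge> e\<close>, or
  \<open>e = 2 * b\<close>; in the last case the chain starts at \<open>W\<close>.
\<close>

lemma sym_mon_nabla_span:
  assumes e: "e \<ge> 1" and W: "\<And>k. e = 2 * k \<Longrightarrow> W = w_2 k"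
    and deg: "a + b = c + d" and inv: "[a + d = b + c] (mod e)"
  shows "sym_mon a b c d \<in> nabla_span e W"
proof -
  have *: "sym_mon a b c 0 \<in> nabla_span e W" if "a + b = c" and "[a = b + c] (mod e)" for a b c
  proof -
    have "[a + 0 = a + 2 * b] (mod e)"
      using that(2) unfolding that(1)[symmetric] by (simp add: mult_2 add_ac)
    then have b: "[2 * b = 0] (mod e)" by (simp only: cong_add_lcancel_nat cong_sym_eq)
    consider "b = 0" | "b \<ge> e" | "b > 0" "b < e" by linarith
    then show ?thesis
    proof cases
      case 1
      then show ?thesis using sym_mon_pure[OF e] that by auto
    next
      case 2
      then show ?thesis using sym_mon_second_exponent_ge[OF e b] that by blast
    next
      case 3
      from b have "e dvd 2 * b" by (simp add: cong_0_iff)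
      then obtain m where m: "2 * b = e * m" by (elim dvdE)
      with 3 have "e * m < e * 2" "0 < e * m" by linarith+
      then have "m = 1" by (simp only: mult_less_cancel1 nat_0_less_mult_iff) linarith
      with m have "e = 2 * b" by simp
      then have "sym_mon 0 b (0 + b) 0 \<in> nabla_span e W"
        using W nabla_span_base(3)[of W] by (simp add: w_2_eq)
      from sym_mon_raise_iter[OF e b _ this, of a] show ?thesis
        using 3 that(1) by auto
    qed
  qed
  show ?thesis
  proof (cases "c \<ge> 1 \<and> d \<ge> 1")
    case True
    then show ?thesis using sym_mon_mixed_in_I_2[OF e inv deg] nabla_span_base(1) by blast
  next
    case False
    then consider "d = 0" | "c = 0" by linarith
    then show ?thesis
    proof cases
      case 1
      then show ?thesis using *[of a b c] deg inv by simp
    next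
      case 2
      then have "[b = a + d] (mod e)" "b + a = d" using deg cong_sym[OF inv] by simp_all
      then show ?thesis using *[of b a d] 2 by (simp only: sym_mon_swap[of a b])
    qed
  qed
qed

lemma D_2_0_nabla_span:
  assumes e: "e \<ge> 1" and W: "\<And>k. e = 2 * k \<Longrightarrow> W = w_2 k"
    and P: "P \<in> carrier (D_2_0 e)"
  obtains F G I where "F \<in> carrier C_nabla" "G \<in> carrier C_nabla" "I \<in> I_2 e"
    "P = (\<lambda>f. F f + G (W f) + I f)"
proof -
  have "P \<in> D_2_part e 0" using P by (simp add: D_2_0_def)
  with e have "P \<in> nabla_span e W"
  proof (rule D_2_part_induct)
    show "(\<lambda>f. 0) \<in> nabla_span e W" by (rule nabla_span_base(1)) (rule I_2_zero)
    show "sym_mon a b c d \<in> nabla_span e W"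
      if "int a + int b - int c - int d = 0" "[a + d = b + c] (mod e)" for a b c d
      using sym_mon_nabla_span[OF e W _ that(2)] that(1) by simp
  qed (rule nabla_span_add nabla_span_scale; assumption)+
  then show thesis using that unfolding nabla_span_def by blast
qed

section \<open>The extra generator is not a polynomial in \<open>\<nabla>\<close>\<close>

lemma d_power_X_power: "(d1 ^^ k) (X1 ^ k) = of_nat (fact k)"
proof (induction k)
  case (Suc k)
  have "(d1 ^^ Suc k) (X1 ^ Suc k) = (d1 ^^ k) (cst (of_nat (Suc k)) * X1 ^ k)"
    using d_X_power(1)[of "Suc k" 1] by (simp only: funpow_Suc_right o_apply cst_of_nat) (simp add: d_zero)
  then show ?case by (simp only: funpow_d_cst Suc) (simp only: cst_of_nat fact_Suc of_nat_mult of_nat_id)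
qed simp

lemma d_power_zero: "(d1 ^^ c) 0 = 0" "(d2 ^^ c) 0 = 0"
  using funpow_d_cst[of c 0 0] by simp_all

lemma d2_power_X1: "(d2 ^^ d) (X1 ^ k) = (if d = 0 then X1 ^ k else 0)"
  using d_X_power(4)[of k 1] by (induction d) (auto simp: d_zero)

lemma d1_power_X1:
  assumes "k < c" shows "(d1 ^^ c) (X1 ^ k) = 0"
proof -
  obtain m where "c = m + Suc k" using assms by (metis add.commute less_imp_Suc_add add_Suc_right)
  moreover have "d1 (of_nat (fact k)) = 0" using d_gens(1)[of "of_nat (fact k)"] by (simp only: cst_of_nat)
  ultimately show ?thesis
    by (simp only: funpow_add o_apply funpow.simps d_power_X_power d_power_zero)
qed

text \<open>
  The image of \<open>x\<^sub>1^k\<close> has degree below \<open>k\<close> and \<open>\<rho>\<close>-eigenvalue \<open>\<epsilon>^k = -1\<close>. A monomial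
  \<open>x\<^sub>1^i x\<^sub>2^j\<close> with this eigenvalue has \<open>i - j\<close> an odd multiple of \<open>k\<close>, hence degree at least
  \<open>k\<close>; so the image is zero.
\<close>

lemma lowering_kills:
  assumes "k \<ge> 1" "n < 0" "P \<in> D_2_part (2 * k) n"
  shows "P (X1 ^ k) = 0"
proof -
  have "2 * k \<ge> 1" using assms by simp
  from this assms(3) show ?thesis
  proof (rule D_2_part_induct)
    fix a b c d
    assume deg: "int a + int b - int c - int d = n" and inv: "[a + d = b + c] (mod 2 * k)"
    have 1: "mon a b c d (X1 ^ k) = 0"
      if "int a + int b - int c - int d = n" "[a + d = b + c] (mod 2 * k)" for a b c d
    proof (cases "d = 0 \<and> c \<le> k")
      case True
      then have *: "a < b + c" "b + c < a + 2 * k"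
        using that(1) assms(2) by auto
      have "[b + c = a] (mod 2 * k)" using that(2) True by (simp add: cong_sym_eq)
      then have "2 * k dvd b + c - a" using * by (simp add: cong_altdef_nat)
      then have False using * by (auto dest: dvd_imp_le)
      then show ?thesis ..
    next
      case False
      then show ?thesis by (auto simp: mon_def d2_power_X1 d1_power_X1 d_power_zero)
    qed
    show "sym_mon a b c d (X1 ^ k) = 0"
      using 1[OF deg inv] 1[of b a d c] deg inv by (simp add: sym_mon_def cong_sym_eq algebra_simps)
  qed simp_all
qed

lemma left_ideal_kills:
  assumes "k \<ge> 1" "P \<in> left_ideal (2 * k)"
  shows "P (X1 ^ k) = 0"
proof -
  have N: "Q (X1 ^ k) = 0" if "Q \<in> D_2_neg (2 * k)" for Q
    using that unfolding D_2_neg_def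
  proof (induction rule: generate.induct)
    case (inv h)
    then have h: "h \<in> carrier (D_2 (2 * k))" "h (X1 ^ k) = 0"
      using lowering_kills[OF assms(1)] by (auto simp: D_2_part_def)
    interpret ring "D_2 (2 * k)" by (rule D_2_ring)
    have "(inv\<^bsub>add_monoid (D_2 (2 * k))\<^esub> h) \<oplus>\<^bsub>D_2 (2 * k)\<^esub> h = \<zero>\<^bsub>D_2 (2 * k)\<^esub>"
      using l_neg[OF h(1)] by (simp add: a_inv_def)
    then have "(inv\<^bsub>add_monoid (D_2 (2 * k))\<^esub> h) (X1 ^ k) + h (X1 ^ k) = 0"
      by (simp add: End_ops fun_eq_iff)
    with h show ?case by simp
  qed (use lowering_kills[OF assms(1)] in \<open>auto simp: End_ops\<close>)
  show ?thesis
    using assms(2) unfolding left_ideal_def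
  proof (induction rule: ideal_prod.induct)
    case (prod i j)
    then have "i \<in> carrier End_B" using subringE(1)[OF D_2_subring] by blast
    then show ?case using N[OF prod(2)] by (simp add: End_ops End_linear)
  qed (simp add: End_ops)
qed

lemma C_nabla_X_power:
  assumes "F \<in> carrier C_nabla" shows "\<exists>k. F (X1 ^ n) = cst k * X1 ^ n"
  using assms
proof (induction rule: C_nabla_induct)
  case nabla
  have "nabla (X1 ^ n) = of_nat n * X1 ^ n"
    using d_X_power(1,4)[of n 1] by (cases n) (simp_all add: nabla_apply x1_def x2_def d_zero algebra_simps)
  then show ?case by (metis cst_of_nat)
next
  case (add F G)
  then show ?case by (metis cst_simps(3) distrib_right)
next
  case (mult F G)
  then show ?case by (metis C_nabla_End End_linear(2) cst_simps(4) mult.assoc)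
qed (auto simp: scal_def)

text \<open>
  Both the left ideal and \<open>\<complex>[\<nabla>]\<close> preserve the line through \<open>x\<^sub>1^k\<close>, but \<open>w_2 k\<close> sends \<open>x\<^sub>1^k\<close>
  to a nonzero multiple of \<open>x\<^sub>2^k\<close>.
\<close>

lemma w_2_not_nabla:
  assumes "k \<ge> 1" "F \<in> carrier C_nabla" "I \<in> I_2 (2 * k)"
  shows "w_2 k \<noteq> (\<lambda>f. I f + F f)"
proof
  assume *: "w_2 k = (\<lambda>f. I f + F f)"
  obtain c where "F (X1 ^ k) = cst c * X1 ^ k" using C_nabla_X_power assms by blast
  moreover have "I (X1 ^ k) = 0" using assms left_ideal_kills by (simp add: I_2_def)
  moreover have "w_2 k (X1 ^ k) = X2 ^ k * of_nat (fact k)"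
    using assms(1) by (simp add: w_2_eq sym_mon_def mon_def d_power_X_power d2_power_X1)
  ultimately have "X2 ^ k * cst (of_nat (fact k)) = cst c * X1 ^ k"
    using * by (simp only: cst_of_nat) simp
  \<comment> \<open>Evaluating at \<open>x\<^sub>1 = 0\<close>, \<open>x\<^sub>2 = 1\<close> separates the two monomials.\<close>
  then have "subst 0 1 (X2 ^ k * cst (of_nat (fact k))) = subst 0 1 (cst c * X1 ^ k)" by simp
  moreover have "subst a b (p ^ k) = subst a b p ^ k" for a b p
    by (induction k) (simp_all add: subst_hom subst_gens)
  ultimately have "cst (of_nat (fact k)) = 0"
    using assms(1) by (simp add: subst_hom subst_gens)
  then show False by (simp add: cst_def)
qed

section \<open>The quotient ring\<close>

lemma cls_hom: "cls e \<in> ring_hom (D_2_0 e) (R_2 e)"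
  using ideal.rcos_ring_hom[OF I_2_ideal] by (simp add: R_2_def cls_def[abs_def])

lemma carrier_R_2: "carrier (R_2 e) = cls e ` carrier (D_2_0 e)"
  by (auto simp: R_2_def FactRing_def A_RCOSETS_def' cls_def)

lemma E_2_eq: "E_2 e = cls e ` carrier C_nabla"
  by (auto simp: E_2_def Pi_2_def)

lemma cls_eqD:
  assumes "P \<in> carrier (D_2_0 e)" "Q \<in> carrier (D_2_0 e)" "cls e P = cls e Q"
  obtains I where "I \<in> I_2 e" "P = (\<lambda>f. I f + Q f)"
proof -
  interpret ideal "I_2 e" "D_2_0 e" by (rule I_2_ideal)
  have "P \<in> I_2 e +>\<^bsub>D_2_0 e\<^esub> Q"
    using a_rcos_self[OF assms(1)] assms(3) by (simp add: cls_def)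
  then show thesis using that by (auto simp: a_r_coset_def' End_ops)
qed

lemma cls_I_2: "I \<in> I_2 e \<Longrightarrow> cls e I = \<zero>\<^bsub>R_2 e\<^esub>"
proof -
  interpret ideal "I_2 e" "D_2_0 e" by (rule I_2_ideal)
  show "I \<in> I_2 e \<Longrightarrow> cls e I = \<zero>\<^bsub>R_2 e\<^esub>"
    using a_rcos_const by (simp add: cls_def R_2_def FactRing_def)
qed

lemma cls_decomp:
  assumes "F \<in> carrier C_nabla" "G \<in> carrier C_nabla" "I \<in> I_2 e" "W \<in> carrier (D_2_0 e)"
  shows "cls e (\<lambda>f. F f + G (W f) + I f) = cls e F \<oplus>\<^bsub>R_2 e\<^esub> cls e G \<otimes>\<^bsub>R_2 e\<^esub> cls e W"
    "(\<lambda>f. F f + G (W f) + I f) \<in> carrier (D_2_0 e)"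
proof -
  interpret ideal "I_2 e" "D_2_0 e" by (rule I_2_ideal)
  interpret R: ring "R_2 e" unfolding R_2_def by (rule quotient_is_ring)
  note c = subsetD[OF C_nabla_sub assms(1)] subsetD[OF C_nabla_sub assms(2)] assms(4)
  have I: "I \<in> carrier (D_2_0 e)" using assms(3) by (rule a_Hcarr)
  have eq: "(\<lambda>f. F f + G (W f) + I f) = (F \<oplus>\<^bsub>D_2_0 e\<^esub> G \<otimes>\<^bsub>D_2_0 e\<^esub> W) \<oplus>\<^bsub>D_2_0 e\<^esub> I"
    by (simp add: End_ops)
  show "cls e (\<lambda>f. F f + G (W f) + I f) = cls e F \<oplus>\<^bsub>R_2 e\<^esub> cls e G \<otimes>\<^bsub>R_2 e\<^esub> cls e W"
    unfolding eq using c I cls_I_2[OF assms(3)]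
    by (simp add: ring_hom_add[OF cls_hom] ring_hom_mult[OF cls_hom] ring_hom_closed[OF cls_hom]
        del: D_2_0_ops)
  show "(\<lambda>f. F f + G (W f) + I f) \<in> carrier (D_2_0 e)"
    unfolding eq using c I by (simp del: D_2_0_ops)
qed

lemma R_2_mem_iff:
  assumes e: "e \<ge> 1" and W: "\<And>k. e = 2 * k \<Longrightarrow> W = w_2 k" "W \<in> carrier (D_2_0 e)"
  shows "x \<in> carrier (R_2 e) \<longleftrightarrow> (\<exists>F \<in> carrier C_nabla. \<exists>G \<in> carrier C_nabla.
    x = cls e F \<oplus>\<^bsub>R_2 e\<^esub> cls e G \<otimes>\<^bsub>R_2 e\<^esub> cls e W)" (is "_ \<longleftrightarrow> ?R")
proof
  assume "x \<in> carrier (R_2 e)"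
  then obtain P where P: "P \<in> carrier (D_2_0 e)" "x = cls e P" by (auto simp: carrier_R_2)
  from D_2_0_nabla_span[OF e W(1) P(1)] obtain F G I where *: "F \<in> carrier C_nabla"
    "G \<in> carrier C_nabla" "I \<in> I_2 e" "P = (\<lambda>f. F f + G (W f) + I f)" by blast
  then show ?R using cls_decomp(1)[OF *(1-3) W(2)] P by auto
next
  assume ?R
  then obtain F G where *: "F \<in> carrier C_nabla" "G \<in> carrier C_nabla"
    "x = cls e F \<oplus>\<^bsub>R_2 e\<^esub> cls e G \<otimes>\<^bsub>R_2 e\<^esub> cls e W" by blast
  show "x \<in> carrier (R_2 e)"
    unfolding *(3) cls_decomp(1)[OF *(1,2) I_2_zero W(2), symmetric] carrier_R_2
    by (rule imageI) (rule cls_decomp(2)[OF *(1,2) I_2_zero W(2)])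
qed

text \<open>
  \<open>R\<^sub>2\<close> is generated over a commutative central subring by the single element \<open>[W]\<close>.
\<close>

lemma R_2_cring:
  assumes e: "e \<ge> 1" and W: "\<And>k. e = 2 * k \<Longrightarrow> W = w_2 k" "W \<in> carrier (D_2_0 e)"
  shows "cring (R_2 e)"
proof -
  interpret R: ring "R_2 e"
    unfolding R_2_def by (rule ideal.quotient_is_ring) (rule I_2_ideal)
  note hom = ring_hom_mult[OF cls_hom]
  have "P \<otimes>\<^bsub>End_B\<^esub> Q = Q \<otimes>\<^bsub>End_B\<^esub> P"
    if "P \<in> carrier C_nabla" "Q \<in> carrier (D_2_0 e)" for P Q
    using C_nabla_commutes[OF that] by (simp add: End_ops)
  then have central: "cls e P \<otimes>\<^bsub>R_2 e\<^esub> x = x \<otimes>\<^bsub>R_2 e\<^esub> cls e P"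
    if "P \<in> carrier C_nabla" "x \<in> carrier (R_2 e)" for P x
    using that hom[of P e] hom[of _ e P] C_nabla_sub[of e] by (auto simp: carrier_R_2)
  have cl: "cls e P \<in> carrier (R_2 e)" if "P \<in> carrier (D_2_0 e)" for P
    using that by (simp add: carrier_R_2)
  define w where "w = cls e W"
  have w: "w \<in> carrier (R_2 e)" using W(2) cl by (simp add: w_def)
  have elem: "\<exists>F \<in> carrier C_nabla. \<exists>G \<in> carrier C_nabla.
      x = cls e F \<oplus>\<^bsub>R_2 e\<^esub> cls e G \<otimes>\<^bsub>R_2 e\<^esub> w" if "x \<in> carrier (R_2 e)" for x
    using R_2_mem_iff[OF e W] that by (simp add: w_def)
  note C = subsetD[OF C_nabla_sub, THEN cl]
  have comm_w: "x \<otimes>\<^bsub>R_2 e\<^esub> w = w \<otimes>\<^bsub>R_2 e\<^esub> x" if "x \<in> carrier (R_2 e)" for x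
  proof -
    obtain F G where FG: "F \<in> carrier C_nabla" "G \<in> carrier C_nabla"
      "x = cls e F \<oplus>\<^bsub>R_2 e\<^esub> cls e G \<otimes>\<^bsub>R_2 e\<^esub> w" using elem \<open>x \<in> _\<close> by blast
    have "w \<otimes>\<^bsub>R_2 e\<^esub> (cls e G \<otimes>\<^bsub>R_2 e\<^esub> w) = (w \<otimes>\<^bsub>R_2 e\<^esub> cls e G) \<otimes>\<^bsub>R_2 e\<^esub> w"
      using C[OF FG(2)] w by (simp add: R.m_assoc)
    also have "\<dots> = (cls e G \<otimes>\<^bsub>R_2 e\<^esub> w) \<otimes>\<^bsub>R_2 e\<^esub> w"
      by (simp only: central[OF FG(2) w])
    finally show ?thesis
      using central[OF FG(1) w] C[OF FG(1)] C[OF FG(2)] w by (simp add: FG R.l_distr R.r_distr)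
  qed
  have "x \<otimes>\<^bsub>R_2 e\<^esub> y = y \<otimes>\<^bsub>R_2 e\<^esub> x" if x: "x \<in> carrier (R_2 e)" and y: "y \<in> carrier (R_2 e)" for x y
  proof -
    obtain F G where FG: "F \<in> carrier C_nabla" "G \<in> carrier C_nabla"
      "y = cls e F \<oplus>\<^bsub>R_2 e\<^esub> cls e G \<otimes>\<^bsub>R_2 e\<^esub> w" using elem y by blast
    note c = C[OF FG(1)] C[OF FG(2)] x w
    have "x \<otimes>\<^bsub>R_2 e\<^esub> (cls e G \<otimes>\<^bsub>R_2 e\<^esub> w) = (x \<otimes>\<^bsub>R_2 e\<^esub> cls e G) \<otimes>\<^bsub>R_2 e\<^esub> w"
      using c by (simp add: R.m_assoc)
    also have "\<dots> = (cls e G \<otimes>\<^bsub>R_2 e\<^esub> x) \<otimes>\<^bsub>R_2 e\<^esub> w"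
      by (simp only: central[OF FG(2) x])
    also have "\<dots> = (cls e G \<otimes>\<^bsub>R_2 e\<^esub> w) \<otimes>\<^bsub>R_2 e\<^esub> x"
      using c comm_w[OF x] by (simp add: R.m_assoc)
    finally show ?thesis
      using central[OF FG(1) x] c by (simp add: FG R.l_distr R.r_distr)
  qed
  then show ?thesis
    by (intro cringI R.abelian_group_axioms R.monoid_comm_monoidI R.l_distr)
qed

theorem proposition6p6:
  fixes e :: nat
  assumes "e \<ge> 1"
  shows "(odd e \<longrightarrow> Pi_2 e ` carrier C_nabla = carrier (R_2 e)) \<and>
    (\<forall>e1. e = 2 * e1 \<longrightarrow>
       carrier (R_2 e) =
         {a \<otimes>\<^bsub>R_2 e\<^esub> cls e \<one>\<^bsub>D_2_0 e\<^esub> \<oplus>\<^bsub>R_2 e\<^esub> b \<otimes>\<^bsub>R_2 e\<^esub> cls e (w_2 e1) | a b.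
            a \<in> E_2 e \<and> b \<in> E_2 e} \<and>
       cls e (w_2 e1) \<notin> E_2 e) \<and>
    cring (R_2 e)"
proof (intro conjI impI allI)
  interpret R: ring "R_2 e"
    unfolding R_2_def by (rule ideal.quotient_is_ring) (rule I_2_ideal)
  have zero: "(\<lambda>f. 0) \<in> carrier (D_2_0 e)" "cls e (\<lambda>f. 0) = \<zero>\<^bsub>R_2 e\<^esub>"
    using subsetD[OF C_nabla_sub C_nabla_zero] cls_I_2[OF I_2_zero] by auto
  have cl: "cls e P \<in> carrier (R_2 e)" if "P \<in> carrier C_nabla" for P
    using subsetD[OF C_nabla_sub that] by (simp add: carrier_R_2)
  show "cring (R_2 e)"
  proof (cases "odd e")
    case True
    show ?thesis by (rule R_2_cring[OF assms _ zero(1)]) (use True in auto)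
  next
    case False
    then have "even e" by simp
    then obtain k where "e = 2 * k" by (rule evenE)
    then show ?thesis by (intro R_2_cring[OF assms _ w_2_D_2_0[OF assms]]) auto
  qed
  {
    assume "odd e"
    then have W: "(\<lambda>f. 0) = w_2 k" if "e = 2 * k" for k using that by simp
    have "x \<in> carrier (R_2 e) \<longleftrightarrow> x \<in> E_2 e" for x
      using R_2_mem_iff[OF assms W zero(1), of x] cl C_nabla_gens(1) by (auto simp: E_2_eq zero(2))
    then show "Pi_2 e ` carrier C_nabla = carrier (R_2 e)" by (auto simp: E_2_def)
  }
  fix k assume k: "e = 2 * k"
  have w_eq: "w_2 k = w_2 l" if "e = 2 * l" for l using that k by simp
  have W: "w_2 k \<in> carrier (D_2_0 e)" by (rule w_2_D_2_0[OF assms k])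
  have "x \<in> carrier (R_2 e) \<longleftrightarrow> (\<exists>a \<in> E_2 e. \<exists>b \<in> E_2 e.
      x = a \<otimes>\<^bsub>R_2 e\<^esub> cls e \<one>\<^bsub>D_2_0 e\<^esub> \<oplus>\<^bsub>R_2 e\<^esub> b \<otimes>\<^bsub>R_2 e\<^esub> cls e (w_2 k))" for x
  proof -
    have one: "a \<otimes>\<^bsub>R_2 e\<^esub> cls e \<one>\<^bsub>D_2_0 e\<^esub> = a" if "a \<in> E_2 e" for a
      using that cl R.r_one by (auto simp: E_2_eq ring_hom_one[OF cls_hom] simp del: D_2_0_ops)
    have "x \<in> carrier (R_2 e) \<longleftrightarrow> (\<exists>a \<in> E_2 e. \<exists>b \<in> E_2 e.
        x = a \<oplus>\<^bsub>R_2 e\<^esub> b \<otimes>\<^bsub>R_2 e\<^esub> cls e (w_2 k))"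
      unfolding E_2_eq using R_2_mem_iff[OF assms w_eq W, of x] by simp
    then show ?thesis by (simp add: one del: D_2_0_ops cong: bex_cong)
  qed
  then show "carrier (R_2 e) =
      {a \<otimes>\<^bsub>R_2 e\<^esub> cls e \<one>\<^bsub>D_2_0 e\<^esub> \<oplus>\<^bsub>R_2 e\<^esub> b \<otimes>\<^bsub>R_2 e\<^esub> cls e (w_2 k) | a b.
        a \<in> E_2 e \<and> b \<in> E_2 e}" by blast
  show "cls e (w_2 k) \<notin> E_2 e"
  proof
    assume "cls e (w_2 k) \<in> E_2 e"
    then obtain F where F: "F \<in> carrier C_nabla" "cls e (w_2 k) = cls e F" by (auto simp: E_2_eq)
    from cls_eqD[OF W subsetD[OF C_nabla_sub F(1)] F(2)]
    obtain I where "I \<in> I_2 e" "w_2 k = (\<lambda>f. I f + F f)" by blast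
    then show False using w_2_not_nabla[of k F I] assms F(1) k by simp
  qed
qed

end
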